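(* Let $R$ be a ring, $s \in R$, and write $\mathrm{Spec}(R) = V(s) \sqcup D(s)$. Suppose both $V(s)$ and $D(s)$ have dimension at most $d$, and let $P = Rp + P_1$ be a projective $R$-module of rank $r \geq d + 1$, where $p \in P$ and $P_1$ is a submodule of $P$. Then $P$ has a unimodular element of the form $p + q$ for some $q \in P_1$. Moreover, if $P \oplus Q \cong P' \oplus Q$ for some projective $R$-modules $P', Q$, then $P \cong P'$.
   Context: All rings are commutative with unity $1 \neq 0$, not necessarily noetherian; all projective modules are finitely generated; "rank $r$" means constant rank $r$. $V(s)$ is the set of prime ideals containing $s$ and $D(s)$ its complement; their dimensions are those of the topological subspaces of $\mathrm{Spec}(R)$ (i.e. the Krull dimensions of $R/sR$ and $R_s$). An element $p$ of a projective $R$-module $P$ is unimodular if $\phi(p) = 1$ for some $\phi \in \mathrm{Hom}_R(P, R)$. *)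

theory Defs
  imports
    "HOL-Algebra.Ideal"
    "HOL-Algebra.Module"
    "HOL-Analysis.Abstract_Topology"
    "HOL-Library.Extended_Real"
begin

text \<open>
  The locale of modules over a ring is written \<open>Module.module\<close> throughout, because \<open>module\<close> alone
  may also denote the type-class based locale of \<open>HOL.Modules\<close>.  The fields \<open>mult\<close> and \<open>one\<close>
  which module records inherit from ring records carry no information and are left \<open>undefined\<close>.
\<close>

section \<open>The prime spectrum\<close>

definition Spec :: "('a, 'k) ring_scheme \<Rightarrow> 'a set set" where
  "Spec R = {I. primeideal I R}"

definition zariski :: "('a, 'k) ring_scheme \<Rightarrow> 'a set topology" where
  "zariski R = topology (\<lambda>U. \<exists>E\<subseteq>carrier R. U = {I \<in> Spec R. \<not> E \<subseteq> I})"

lemma istopology_zariski: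
  "istopology (\<lambda>U. \<exists>E\<subseteq>carrier R. U = {I \<in> Spec R. \<not> E \<subseteq> I})"
  for R (structure)
  unfolding istopology_def
proof (intro conjI allI impI)
  fix U V
  assume "\<exists>E\<subseteq>carrier R. U = {I \<in> Spec R. \<not> E \<subseteq> I}" "\<exists>E\<subseteq>carrier R. V = {I \<in> Spec R. \<not> E \<subseteq> I}"
  then obtain E F where E: "E \<subseteq> carrier R" "U = {I \<in> Spec R. \<not> E \<subseteq> I}"
    and F: "F \<subseteq> carrier R" "V = {I \<in> Spec R. \<not> F \<subseteq> I}"
    by auto
  define G where "G = {a \<otimes> b | a b. a \<in> E \<and> b \<in> F}"
  have *: "\<not> G \<subseteq> I \<longleftrightarrow> \<not> E \<subseteq> I \<and> \<not> F \<subseteq> I" if "I \<in> Spec R" for I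
  proof -
    interpret primeideal I R using that by (simp add: Spec_def)
    show ?thesis
    proof
      assume "\<not> G \<subseteq> I"
      then obtain a b where "a \<in> E" "b \<in> F" "a \<otimes> b \<notin> I" unfolding G_def by auto
      then show "\<not> E \<subseteq> I \<and> \<not> F \<subseteq> I" using I_l_closed I_r_closed E(1) F(1) by blast
    next
      assume "\<not> E \<subseteq> I \<and> \<not> F \<subseteq> I"
      then obtain a b where ab: "a \<in> E" "b \<in> F" "a \<notin> I" "b \<notin> I" by blast
      then have "a \<otimes> b \<notin> I" using I_prime E(1) F(1) by blast
      then show "\<not> G \<subseteq> I" using ab unfolding G_def by blast
    qed
  qed
  have G: "G \<subseteq> carrier R" if "I \<in> Spec R" for I
  proof -
    interpret primeideal I R using that by (simp add: Spec_def)
    show ?thesis using E(1) F(1) unfolding G_def by auto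
  qed
  show "\<exists>H\<subseteq>carrier R. U \<inter> V = {I \<in> Spec R. \<not> H \<subseteq> I}"
  proof (cases "Spec R = {}")
    case True
    then show ?thesis using E by auto
  next
    case False
    then have "G \<subseteq> carrier R" using G by auto
    moreover have "U \<inter> V = {I \<in> Spec R. \<not> G \<subseteq> I}" using * E(2) F(2) by blast
    ultimately show ?thesis by blast
  qed
next
  fix \<U> assume "\<forall>U\<in>\<U>. \<exists>E\<subseteq>carrier R. U = {I \<in> Spec R. \<not> E \<subseteq> I}"
  then obtain E where E: "\<And>U. U \<in> \<U> \<Longrightarrow> E U \<subseteq> carrier R \<and> U = {I \<in> Spec R. \<not> E U \<subseteq> I}"
    by metis
  have "\<Union>\<U> = {I \<in> Spec R. \<not> (\<Union>U\<in>\<U>. E U) \<subseteq> I}"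
    using E by (auto 5 4)
  then show "\<exists>H\<subseteq>carrier R. \<Union>\<U> = {I \<in> Spec R. \<not> H \<subseteq> I}"
    using E by (intro exI[of _ "\<Union>U\<in>\<U>. E U"]) auto
qed

definition vanishing_set :: "('a, 'k) ring_scheme \<Rightarrow> 'a \<Rightarrow> 'a set set" where
  "vanishing_set R s = {I \<in> Spec R. s \<in> I}"

definition nonvanishing_set :: "('a, 'k) ring_scheme \<Rightarrow> 'a \<Rightarrow> 'a set set" where
  "nonvanishing_set R s = Spec R - vanishing_set R s"

definition irreducible_closedin :: "'x topology \<Rightarrow> 'x set \<Rightarrow> bool" where
  "irreducible_closedin X Z \<longleftrightarrow> closedin X Z \<and> Z \<noteq> {} \<and>
     (\<forall>A B. closedin X A \<and> closedin X B \<and> Z = A \<union> B \<longrightarrow> Z = A \<or> Z = B)"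

text \<open>The empty space has dimension \<open>-\<infinity>\<close>, the supremum of the empty set.\<close>

definition krull_dim :: "'x topology \<Rightarrow> ereal" where
  "krull_dim X = Sup {ereal (real n) | n.
     \<exists>Z :: nat \<Rightarrow> 'x set. (\<forall>i\<le>n. irreducible_closedin X (Z i)) \<and> (\<forall>i<n. Z i \<subset> Z (Suc i))}"

section \<open>Modules\<close>

definition module_hom ::
  "('a, 'k) ring_scheme \<Rightarrow> ('a, 'b, 'm) module_scheme \<Rightarrow> ('a, 'c, 'n) module_scheme \<Rightarrow> ('b \<Rightarrow> 'c) set"
  where
  "module_hom R M N = {f. f \<in> carrier M \<rightarrow> carrier N \<and>
     (\<forall>x\<in>carrier M. \<forall>y\<in>carrier M. f (x \<oplus>\<^bsub>M\<^esub> y) = f x \<oplus>\<^bsub>N\<^esub> f y) \<and>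
     (\<forall>a\<in>carrier R. \<forall>x\<in>carrier M. f (a \<odot>\<^bsub>M\<^esub> x) = a \<odot>\<^bsub>N\<^esub> f x)}"

definition module_iso ::
  "('a, 'k) ring_scheme \<Rightarrow> ('a, 'b, 'm) module_scheme \<Rightarrow> ('a, 'c, 'n) module_scheme \<Rightarrow> bool"
  where
  "module_iso R M N \<longleftrightarrow> (\<exists>f\<in>module_hom R M N. bij_betw f (carrier M) (carrier N))"

definition regular_module :: "('a, 'k) ring_scheme \<Rightarrow> ('a, 'a) module" where
  "regular_module R =
     \<lparr>carrier = carrier R, monoid.mult = undefined, one = undefined,
      zero = \<zero>\<^bsub>R\<^esub>, add = add R, smult = monoid.mult R\<rparr>"

definition direct_sum ::
  "('a, 'b, 'm) module_scheme \<Rightarrow> ('a, 'c, 'n) module_scheme \<Rightarrow> ('a, 'b \<times> 'c) module"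
  where
  "direct_sum M N =
     \<lparr>carrier = carrier M \<times> carrier N, monoid.mult = undefined, one = undefined,
      zero = (\<zero>\<^bsub>M\<^esub>, \<zero>\<^bsub>N\<^esub>),
      add = (\<lambda>(x, y) (x', y'). (x \<oplus>\<^bsub>M\<^esub> x', y \<oplus>\<^bsub>N\<^esub> y')),
      smult = (\<lambda>a (x, y). (a \<odot>\<^bsub>M\<^esub> x, a \<odot>\<^bsub>N\<^esub> y))\<rparr>"

text \<open>The free module with basis \<open>X\<close>: finitely supported functions \<open>X \<rightarrow> R\<close>, extended by zero.\<close>

definition free_module :: "('a, 'k) ring_scheme \<Rightarrow> 'x set \<Rightarrow> ('a, 'x \<Rightarrow> 'a) module" where
  "free_module R X =
     \<lparr>carrier = {f. f \<in> X \<rightarrow> carrier R \<and> (\<forall>x. x \<notin> X \<longrightarrow> f x = \<zero>\<^bsub>R\<^esub>) \<and> finite {x. f x \<noteq> \<zero>\<^bsub>R\<^esub>}},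
      monoid.mult = undefined, one = undefined,
      zero = (\<lambda>_. \<zero>\<^bsub>R\<^esub>),
      add = (\<lambda>f g x. f x \<oplus>\<^bsub>R\<^esub> g x),
      smult = (\<lambda>a f x. a \<otimes>\<^bsub>R\<^esub> f x)\<rparr>"

definition finitely_generated :: "('a, 'k) ring_scheme \<Rightarrow> ('a, 'b, 'm) module_scheme \<Rightarrow> bool" where
  "finitely_generated R M \<longleftrightarrow>
     (\<exists>S. finite S \<and> S \<subseteq> carrier M \<and> (\<forall>H. submodule H R M \<and> S \<subseteq> H \<longrightarrow> H = carrier M))"

text \<open>
  A projective module is a direct summand of a free module.  Fixing the types of the basis and of
  the complement is no restriction: if \<open>M\<close> is a direct summand of any free module, then it is one
  of the free module with basis \<open>carrier M\<close>, and the complement can be taken to be a submodule of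
  that free module.
\<close>

definition projective :: "('a, 'k) ring_scheme \<Rightarrow> ('a, 'b, 'm) module_scheme \<Rightarrow> bool" where
  "projective R M \<longleftrightarrow> Module.module R M \<and>
     (\<exists>(X :: 'b set) (N :: ('a, 'b \<Rightarrow> 'a) module).
        Module.module R N \<and> module_iso R (direct_sum M N) (free_module R X))"

definition fg_projective :: "('a, 'k) ring_scheme \<Rightarrow> ('a, 'b, 'm) module_scheme \<Rightarrow> bool" where
  "fg_projective R M \<longleftrightarrow> finitely_generated R M \<and> projective R M"

definition unimodular :: "('a, 'k) ring_scheme \<Rightarrow> ('a, 'b, 'm) module_scheme \<Rightarrow> 'b \<Rightarrow> bool" where
  "unimodular R M x \<longleftrightarrow>
     x \<in> carrier M \<and> (\<exists>\<phi>\<in>module_hom R M (regular_module R). \<phi> x = \<one>\<^bsub>R\<^esub>)"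

section \<open>Localization and rank\<close>

text \<open>
  \<open>S\<close> is a multiplicative subset of \<open>R\<close>.  Fractions are equivalence classes of pairs, and
  operations on them are unions over all representatives (all of which give the same class).
\<close>

definition fraction_rel ::
  "('a, 'k) ring_scheme \<Rightarrow> 'a set \<Rightarrow> ('a, 'b, 'm) module_scheme \<Rightarrow> (('b \<times> 'a) \<times> ('b \<times> 'a)) set"
  where
  "fraction_rel R S M = {((x, s), (y, t)). x \<in> carrier M \<and> s \<in> S \<and> y \<in> carrier M \<and> t \<in> S \<and>
     (\<exists>u\<in>S. u \<odot>\<^bsub>M\<^esub> (t \<odot>\<^bsub>M\<^esub> x) = u \<odot>\<^bsub>M\<^esub> (s \<odot>\<^bsub>M\<^esub> y))}"

definition fraction ::
  "('a, 'k) ring_scheme \<Rightarrow> 'a set \<Rightarrow> ('a, 'b, 'm) module_scheme \<Rightarrow> 'b \<Rightarrow> 'a \<Rightarrow> ('b \<times> 'a) set"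
  where
  "fraction R S M x s = fraction_rel R S M `` {(x, s)}"

definition loc_module ::
  "('a, 'k) ring_scheme \<Rightarrow> 'a set \<Rightarrow> ('a, 'b, 'm) module_scheme \<Rightarrow>
     (('a \<times> 'a) set, ('b \<times> 'a) set) module"
  where
  "loc_module R S M =
     \<lparr>carrier = (carrier M \<times> S) // fraction_rel R S M,
      monoid.mult = undefined, one = undefined,
      zero = fraction R S M \<zero>\<^bsub>M\<^esub> \<one>\<^bsub>R\<^esub>,
      add = (\<lambda>X Y. \<Union>(x, s)\<in>X. \<Union>(y, t)\<in>Y.
               fraction R S M ((t \<odot>\<^bsub>M\<^esub> x) \<oplus>\<^bsub>M\<^esub> (s \<odot>\<^bsub>M\<^esub> y)) (s \<otimes>\<^bsub>R\<^esub> t)),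
      smult = (\<lambda>A X. \<Union>(a, s)\<in>A. \<Union>(x, t)\<in>X. fraction R S M (a \<odot>\<^bsub>M\<^esub> x) (s \<otimes>\<^bsub>R\<^esub> t))\<rparr>"

definition loc_ring :: "('a, 'k) ring_scheme \<Rightarrow> 'a set \<Rightarrow> ('a \<times> 'a) set ring" where
  "loc_ring R S =
     (let L = loc_module R S (regular_module R) in
      \<lparr>carrier = carrier L, monoid.mult = smult L, one = fraction R S (regular_module R) \<one>\<^bsub>R\<^esub> \<one>\<^bsub>R\<^esub>,
       zero = zero L, add = add L\<rparr>)"

definition has_constant_rank ::
  "('a, 'k) ring_scheme \<Rightarrow> ('a, 'b, 'm) module_scheme \<Rightarrow> nat \<Rightarrow> bool"
  where
  "has_constant_rank R M r \<longleftrightarrow>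
     (\<forall>I\<in>Spec R. let S = carrier R - I in
        module_iso (loc_ring R S) (loc_module R S M) (free_module (loc_ring R S) {..<r}))"

end

theory Submission
  imports Defs "HOL-Algebra.Ring_Divisibility"
begin

text \<open>
  The spectrum enters the proof through one statement in the spirit of Kronecker's theorem on
  generating ideals up to radical: if \<open>V(s)\<close> and \<open>D(s)\<close> both have dimension less than \<open>n\<close>, then for
  all ring elements \<open>a\<close> and \<open>b\<^sub>1, \<dots>, b\<^sub>n\<close> there are \<open>x\<^sub>1, \<dots>, x\<^sub>n\<close> such that every prime containing all
  the \<open>b\<^sub>i + a x\<^sub>i\<close> contains \<open>a\<close> (\<open>kronecker_range_two_strata\<close>).  It is proved on \<open>V(s)\<close> first; the
  correction needed afterwards on \<open>D(s)\<close> can be taken divisible by \<open>s\<close>, so it does not disturb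
  what holds on \<open>V(s)\<close>.  On a single stratum the proof is an induction on \<open>n\<close> in which the stratum
  is replaced by the boundary of the locus where \<open>b\<^sub>n\<close> vanishes, whose dimension is smaller.

  The rank of \<open>P\<close> enters through frames: linear forms \<open>\<phi>\<^sub>1, \<dots>, \<phi>\<^sub>n\<close> and elements \<open>x\<^sub>1, \<dots>, x\<^sub>n\<close> with
  \<open>\<phi>\<^sub>i(x\<^sub>j) = \<delta>\<close> for \<open>i = j\<close> and \<open>0\<close> otherwise.  If \<open>P\<close> has constant rank \<open>n\<close>, then at each prime
  there is a frame whose \<open>\<delta>\<close> lies outside that prime (\<open>local_frames_if_constant_rank\<close>): clear the
  denominators of a basis of the localization and of its coordinate forms.  Given a frame and
  \<open>p \<in> P\<close>, apply the Kronecker statement to the \<open>\<phi>\<^sub>i(p)\<close> and \<open>a = \<delta>\<^sup>2\<close>, and add \<open>\<delta> \<Sum> y\<^sub>j x\<^sub>j\<close> to \<open>p\<close>,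
  where the \<open>y\<^sub>j\<close> are the resulting coefficients.
  A prime at which all linear forms vanish on the new element then contains \<open>\<delta>\<close>; and since the
  element has not changed modulo \<open>\<delta>\<close>, all linear forms vanish there on the old one as well
  (\<open>absorb_frame\<close>).  The set of primes at which \<open>p\<close> vanishes can thus be shrunk by one \<open>\<delta>\<close> after
  another, and the elements of the ring for which this is possible form an ideal; this ideal lies
  in no prime, so \<open>p\<close> can be made to vanish nowhere, that is, unimodular (\<open>unimodular_in_coset\<close>).

  For the first claim the \<open>x\<^sub>j\<close> must be moved into \<open>P\<^sub>1\<close> at the primes where \<open>p\<close> vanishes; this changes
  the matrix of the frame by a matrix of rank one, which is inverted explicitly
  (\<open>frame_in_complement\<close>).

  For the second claim, \<open>Q\<close> is a direct summand of a finite free module, so it can be replaced by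
  a free module and then by \<open>R\<close>, one coordinate at a time.  Given \<open>P \<oplus> R \<cong> P' \<oplus> R\<close>, let
  \<open>(p, a) \<in> P \<oplus> R\<close> correspond to \<open>(0, 1) \<in> P' \<oplus> R\<close>.  The splitting argument, with the \<open>x\<^sub>j\<close>
  multiplied by \<open>a\<close>, gives \<open>q\<close> such that \<open>p + a q\<close> is unimodular, and then elementary automorphisms
  of \<open>P \<oplus> R\<close> carry \<open>(p, a)\<close> to \<open>(0, 1)\<close>.  Dividing out these elements on both sides gives
  \<open>P \<cong> P'\<close> (\<open>cancel_regular_module\<close>).
\<close>

section \<open>Prime ideals avoiding a multiplicative set\<close>

text \<open>
  An ideal \<open>M\<close> that is maximal among those containing \<open>I\<close> and disjoint from \<open>S\<close> is prime: if it
  contained neither \<open>a\<close> nor \<open>b\<close>, then \<open>M + Ra\<close> and \<open>M + Rb\<close> would both meet \<open>S\<close>, and the product of two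
  such elements would lie in \<open>S\<close> and, when \<open>ab \<in> M\<close>, also in \<open>M\<close>.
\<close>

lemma (in cring) prime_ideal_avoiding:
  assumes I: "ideal I R"
    and S: "S \<subseteq> carrier R" "\<one> \<in> S" "\<And>x y. x \<in> S \<Longrightarrow> y \<in> S \<Longrightarrow> x \<otimes> y \<in> S"
    and disj: "I \<inter> S = {}"
  obtains Q where "primeideal Q R" "I \<subseteq> Q" "Q \<inter> S = {}"
proof -
  define A where "A = {J. ideal J R \<and> I \<subseteq> J \<and> J \<inter> S = {}}"
  have "\<exists>M\<in>A. \<forall>J\<in>A. M \<subseteq> J \<longrightarrow> J = M"
  proof (rule subset_Zorn_nonempty)
    show "A \<noteq> {}" using I disj by (auto simp: A_def)
    fix C assume C: "C \<noteq> {}" "subset.chain A C"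
    then have "subset.chain {J. ideal J R} C"
      unfolding A_def pred_on.chain_def by auto
    then have Un: "ideal (\<Union>C) R" using chain_Union_is_ideal[of C] C(1) by simp
    have CA: "\<And>J. J \<in> C \<Longrightarrow> J \<in> A" using C(2) by (auto simp: pred_on.chain_def)
    obtain J where "J \<in> C" using C(1) by auto
    then have "I \<subseteq> J" using CA by (simp add: A_def)
    then have "I \<subseteq> \<Union>C" using \<open>J \<in> C\<close> by blast
    moreover have "x \<notin> S" if "x \<in> K" "K \<in> C" for x K
    proof -
      have "K \<inter> S = {}" using CA[OF that(2)] by (simp add: A_def)
      then show ?thesis using that(1) by (simp add: disjoint_iff)
    qed
    then have "\<Union>C \<inter> S = {}" by (auto simp: disjoint_iff)
    ultimately show "\<Union>C \<in> A" using Un by (simp add: A_def)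
  qed
  then obtain M where MA: "M \<in> A" and max: "\<forall>J\<in>A. M \<subseteq> J \<longrightarrow> J = M"
    by (rule bexE)
  have M: "ideal M R" "I \<subseteq> M" "M \<inter> S = {}" using MA by (simp_all add: A_def)
  interpret M: ideal M R by fact
  have hits: "\<exists>m\<in>M. \<exists>x\<in>carrier R. m \<oplus> x \<otimes> a \<in> S" if a: "a \<in> carrier R" "a \<notin> M" for a
  proof (rule ccontr)
    assume no: "\<not> ?thesis"
    let ?J = "M <+>\<^bsub>R\<^esub> PIdl a"
    have J: "ideal ?J R" using add_ideals[OF M(1) cgenideal_ideal[OF a(1)]] .
    have mem: "j \<in> ?J \<longleftrightarrow> (\<exists>m\<in>M. \<exists>x\<in>carrier R. j = m \<oplus> x \<otimes> a)" for j
      unfolding set_add_def' cgenideal_def by auto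
    have "M \<subseteq> ?J"
    proof
      fix m assume m: "m \<in> M"
      have "m = m \<oplus> \<zero> \<otimes> a" using M.Icarr[OF m] a by simp
      with m show "m \<in> ?J" unfolding mem by blast
    qed
    moreover have "?J \<inter> S = {}" using no mem by (auto simp: disjoint_iff)
    ultimately have "?J \<in> A" "M \<subseteq> ?J"
      using J order_trans[OF M(2), of ?J] by (simp_all add: A_def)
    then have "?J = M" using max by simp
    moreover have "a = \<zero> \<oplus> \<one> \<otimes> a" using a by simp
    then have "a \<in> ?J" unfolding mem using M.zero_closed by blast
    ultimately show False using a(2) by simp
  qed
  have "primeideal M R"
  proof (rule primeidealI[OF M(1) is_cring])
    show "carrier R \<noteq> M" using S(2) M(3) by auto
    fix a b assume ab: "a \<in> carrier R" "b \<in> carrier R" "a \<otimes> b \<in> M"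
    show "a \<in> M \<or> b \<in> M"
    proof (rule ccontr)
      assume "\<not> (a \<in> M \<or> b \<in> M)"
      then obtain m x n y where mx: "m \<in> M" "x \<in> carrier R" "m \<oplus> x \<otimes> a \<in> S"
        and ny: "n \<in> M" "y \<in> carrier R" "n \<oplus> y \<otimes> b \<in> S"
        using hits ab by meson
      note c = ab(1,2) mx(2) ny(2) M.Icarr[OF mx(1)] M.Icarr[OF ny(1)]
      have "(m \<oplus> x \<otimes> a) \<otimes> (n \<oplus> y \<otimes> b) =
          (n \<oplus> y \<otimes> b) \<otimes> m \<oplus> ((x \<otimes> a) \<otimes> n \<oplus> (x \<otimes> y) \<otimes> (a \<otimes> b))"
        using c by algebra
      also have "\<dots> \<in> M"
        
        by (rule M.a_closed[OF M.I_l_closed M.a_closed[OF M.I_l_closed M.I_l_closed]])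
          (use c mx(1) ny(1) ab(3) in auto)
      finally show False using S(3)[OF mx(3) ny(3)] M(3) by blast
    qed
  qed
  then show thesis using that M by blast
qed

lemma (in primeideal) nat_pow_in_prime:
  assumes "a \<in> carrier R" "a [^] (k::nat) \<in> I"
  shows "a \<in> I"
  using assms(2)
proof (induction k)
  case 0
  then show ?case using one_imp_carrier I_notcarr by simp
next
  case (Suc k)
  then show ?case using I_prime[of "a [^] k" a] assms(1) by auto
qed

lemma (in primeideal) one_notin: "\<one> \<notin> I"
  using one_imp_carrier I_notcarr by blast

lemma (in ideal) add_mem_cancel:
  assumes "x \<oplus> y \<in> I" "y \<in> I" "x \<in> carrier R"
  shows "x \<in> I"
proof -
  have "x = (x \<oplus> y) \<oplus> (\<ominus> y)" using assms Icarr[OF assms(2)] by (simp add: a_assoc r_neg)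
  also have "\<dots> \<in> I" using assms by simp
  finally show ?thesis .
qed

lemma ideal_finsum:
  assumes I: "ideal I R" and "g \<in> A \<rightarrow> I" "finite A"
  shows "finsum R g A \<in> I"
proof -
  interpret ideal I R by fact
  show ?thesis using assms(3,2)
  proof (induction A)
    case empty
    then show ?case by simp
  next
    case (insert k A)
    then have "g \<in> A \<rightarrow> carrier R" "g k \<in> carrier R" by (auto simp: Pi_iff)
    with insert show ?case by (simp add: Pi_iff)
  qed
qed

section \<open>Dimension in terms of chains of primes\<close>

text \<open>
  Chains of \<open>n + 1\<close> members are counted as having length \<open>n\<close>, so that \<open>\<not> has_chain X n\<close> says that
  \<open>X\<close> has dimension less than \<open>n\<close>.
\<close>

definition has_chain :: "'a set set \<Rightarrow> nat \<Rightarrow> bool" where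
  "has_chain X n \<longleftrightarrow> (\<exists>Z. (\<forall>i\<le>n. Z i \<in> X) \<and> (\<forall>i<n. Z i \<subset> Z (Suc i)))"

lemma closedin_zariski:
  "closedin (zariski R) T \<longleftrightarrow> (\<exists>E\<subseteq>carrier R. T = {Q \<in> Spec R. E \<subseteq> Q})"
proof -
  have op: "openin (zariski R) U \<longleftrightarrow> (\<exists>E\<subseteq>carrier R. U = {I \<in> Spec R. \<not> E \<subseteq> I})" for U
    unfolding zariski_def using topology_inverse'[OF istopology_zariski[of R]] by simp
  have carr: "Q \<subseteq> carrier R" if "Q \<in> Spec R" for Q
    using that additive_subgroup.a_subset[OF ideal.axioms(1)[OF primeideal.axioms(1)]]
    by (auto simp: Spec_def)
  have one: "\<one>\<^bsub>R\<^esub> \<in> carrier R \<and> \<one>\<^bsub>R\<^esub> \<notin> Q" if "Q \<in> Spec R" for Q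
  proof -
    interpret primeideal Q R using that by (simp add: Spec_def)
    show ?thesis using one_notin by simp
  qed
  have top: "topspace (zariski R) = Spec R"
  proof
    show "topspace (zariski R) \<subseteq> Spec R"
      unfolding topspace_def op by auto
    have "Spec R = {I \<in> Spec R. \<not> carrier R \<subseteq> I}" using one by blast
    then have "openin (zariski R) (Spec R)" unfolding op by blast
    then show "Spec R \<subseteq> topspace (zariski R)" by (rule openin_subset)
  qed
  show ?thesis
  proof
    assume "closedin (zariski R) T"
    then obtain E where T: "T \<subseteq> Spec R" and E: "E \<subseteq> carrier R" "Spec R - T = {I \<in> Spec R. \<not> E \<subseteq> I}"
      unfolding closedin_def top op by auto
    have "T = {Q \<in> Spec R. E \<subseteq> Q}" using T E(2) by blast
    with E(1) show "\<exists>E\<subseteq>carrier R. T = {Q \<in> Spec R. E \<subseteq> Q}" by blast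
  next
    assume "\<exists>E\<subseteq>carrier R. T = {Q \<in> Spec R. E \<subseteq> Q}"
    then obtain E where E: "E \<subseteq> carrier R" "T = {Q \<in> Spec R. E \<subseteq> Q}" by blast
    then have "Spec R - T = {I \<in> Spec R. \<not> E \<subseteq> I}" by blast
    then show "closedin (zariski R) T"
      unfolding closedin_def top op using E by blast
  qed
qed

text \<open>
  A prime \<open>Q \<in> X\<close> generates the closed set \<open>V(Q) \<inter> X\<close>, which is irreducible because a closed subset
  containing the point \<open>Q\<close> is everything.  Inclusions are reversed, so a chain of primes gives a chain
  of irreducible closed sets of the same length.
\<close>

lemma no_chain_if_krull_dim_le:
  assumes X: "X \<subseteq> Spec R"
    and dim: "krull_dim (subtopology (zariski R) X) \<le> ereal (real d)"
    and n: "d < n"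
  shows "\<not> has_chain X n"
proof
  assume "has_chain X n"
  then obtain Z where Z: "\<And>i. i \<le> n \<Longrightarrow> Z i \<in> X" "\<And>i. i < n \<Longrightarrow> Z i \<subset> Z (Suc i)"
    unfolding has_chain_def by blast
  let ?T = "subtopology (zariski R) X"
  define V where "V Q = {Q' \<in> X. Q \<subseteq> Q'}" for Q
  have carr: "Q \<subseteq> carrier R" if "Q \<in> X" for Q
    using that X additive_subgroup.a_subset[OF ideal.axioms(1)[OF primeideal.axioms(1)]]
    by (auto simp: Spec_def)
  have cl: "closedin ?T A \<longleftrightarrow> (\<exists>E\<subseteq>carrier R. A = {Q \<in> X. E \<subseteq> Q})" for A
  proof -
    have "{Q \<in> Spec R. E \<subseteq> Q} \<inter> X = {Q \<in> X. E \<subseteq> Q}" for E using X by blast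
    then show ?thesis unfolding closedin_subtopology closedin_zariski by metis
  qed
  have irr: "irreducible_closedin ?T (V Q)" if Q: "Q \<in> X" for Q
    unfolding irreducible_closedin_def
  proof (intro conjI allI impI)
    show "closedin ?T (V Q)" unfolding cl V_def using carr[OF Q] by blast
    show "V Q \<noteq> {}" using Q by (auto simp: V_def)
    fix A B assume AB: "closedin ?T A \<and> closedin ?T B \<and> V Q = A \<union> B"
    have sub: "V Q \<subseteq> C" if "closedin ?T C" "Q \<in> C" for C
      using that unfolding cl V_def by blast
    have "Q \<in> A \<or> Q \<in> B" using AB Q by (auto simp: V_def)
    then show "V Q = A \<or> V Q = B" using sub AB by blast
  qed
  define W where "W i = V (Z (n - i))" for i
  have "irreducible_closedin ?T (W i)" if "i \<le> n" for i
    unfolding W_def using irr Z(1) by simp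
  moreover have "W i \<subset> W (Suc i)" if i: "i < n" for i
  proof -
    have lt: "Z (n - Suc i) \<subset> Z (n - i)" using Z(2)[of "n - Suc i"] i by (simp add: Suc_diff_Suc)
    have "Z (n - Suc i) \<in> X" using Z(1) by simp
    then have "Z (n - Suc i) \<in> W (Suc i) - W i" using lt by (auto simp: W_def V_def)
    moreover have "W i \<subseteq> W (Suc i)" using lt by (auto simp: W_def V_def)
    ultimately show ?thesis by blast
  qed
  ultimately have "ereal (real n) \<le> krull_dim ?T"
    unfolding krull_dim_def by (intro Sup_upper) blast
  then have "ereal (real n) \<le> ereal (real d)" using dim by (rule order_trans)
  then show False using n by simp
qed

text \<open>
  The locally closed set \<open>V(I) \<inter> D(s)\<close>.
\<close>

definition stratum :: "('a, 'k) ring_scheme \<Rightarrow> 'a set \<Rightarrow> 'a \<Rightarrow> 'a set set" where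
  "stratum R I s = {Q \<in> Spec R. I \<subseteq> Q \<and> s \<notin> Q}"

text \<open>
  The ring elements vanishing on the part of the stratum where \<open>b \<noteq> 0\<close>.  For an ideal \<open>I\<close> this is the
  quotient of the radical of \<open>I\<close> by \<open>b s\<close>.
\<close>

definition residual :: "('a, 'k) ring_scheme \<Rightarrow> 'a set \<Rightarrow> 'a \<Rightarrow> 'a \<Rightarrow> 'a set" where
  "residual R I s b = {v \<in> carrier R. \<forall>Q\<in>stratum R I s. v \<otimes>\<^bsub>R\<^esub> b \<in> Q}"

lemma (in cring) residual_ideal:
  assumes "b \<in> carrier R"
  shows "ideal (residual R I s b) R"
proof (rule idealI[OF ring_axioms])
  have pr: "ideal Q R" if "Q \<in> stratum R I s" for Q
    using that primeideal.axioms(1) by (auto simp: stratum_def Spec_def)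
  show "subgroup (residual R I s b) (add_monoid R)"
  proof (rule add.subgroupI)
    show "residual R I s b \<subseteq> carrier R" by (auto simp: residual_def)
    have "\<zero> \<in> residual R I s b"
      using assms additive_subgroup.zero_closed[OF ideal.axioms(1)[OF pr]]
      by (auto simp: residual_def)
    then show "residual R I s b \<noteq> {}" by blast
    fix v assume v: "v \<in> residual R I s b"
    show "\<ominus> v \<in> residual R I s b"
      using v assms additive_subgroup.a_inv_closed[OF ideal.axioms(1)[OF pr]]
      by (auto simp: residual_def l_minus)
    fix w assume w: "w \<in> residual R I s b"
    show "v \<oplus> w \<in> residual R I s b"
      using v w assms additive_subgroup.a_closed[OF ideal.axioms(1)[OF pr]]
      by (auto simp: residual_def l_distr)
  qed
  fix v x assume v: "v \<in> residual R I s b" and x: "x \<in> carrier R"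
  show "x \<otimes> v \<in> residual R I s b"
    using v x assms ideal.I_l_closed[OF pr] by (auto simp: residual_def m_assoc)
  then show "v \<otimes> x \<in> residual R I s b"
    using v x by (simp add: residual_def m_comm)
qed

text \<open>
  Within the stratum, the zeros of this ideal form the intersection of the locus \<open>b = 0\<close> with the
  closure of the locus \<open>b \<noteq> 0\<close>.  It is a relative form of the boundary ideal of \<open>b\<close> used in the
  constructive theory of Krull dimension.
\<close>

definition boundary :: "('a, 'k) ring_scheme \<Rightarrow> 'a set \<Rightarrow> 'a \<Rightarrow> 'a \<Rightarrow> 'a set" where
  "boundary R I s b = residual R I s b <+>\<^bsub>R\<^esub> PIdl\<^bsub>R\<^esub> b"

lemma (in cring) boundary_ideal:
  assumes "b \<in> carrier R"
  shows "ideal (boundary R I s b) R"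
  unfolding boundary_def using add_ideals residual_ideal cgenideal_ideal assms by blast

lemma (in cring) boundary_supersets:
  assumes b: "b \<in> carrier R"
  shows "residual R I s b \<subseteq> boundary R I s b" "b \<in> boundary R I s b"
proof -
  interpret V: ideal "residual R I s b" R using residual_ideal[OF b] .
  have mem: "j \<in> boundary R I s b \<longleftrightarrow> (\<exists>m\<in>residual R I s b. \<exists>x\<in>carrier R. j = m \<oplus> x \<otimes> b)" for j
    unfolding boundary_def set_add_def' cgenideal_def by auto
  show "residual R I s b \<subseteq> boundary R I s b"
  proof
    fix m assume m: "m \<in> residual R I s b"
    have "m = m \<oplus> \<zero> \<otimes> b" using V.Icarr[OF m] b by simp
    with m show "m \<in> boundary R I s b" unfolding mem by blast
  qed
  have "b = \<zero> \<oplus> \<one> \<otimes> b" using b by simp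
  then show "b \<in> boundary R I s b" unfolding mem using V.zero_closed by blast
qed

text \<open>
  A prime \<open>p\<close> in the boundary contains \<open>b\<close> but has a strictly smaller prime \<open>q\<close> of the stratum below
  it, and this \<open>q\<close> extends every chain starting at \<open>p\<close>.  To find \<open>q\<close>, avoid the multiplicative set
  generated by \<open>b s\<close> and the complement of \<open>p\<close>; it is disjoint from \<open>I\<close>, since an element
  \<open>u (b s)\<^sup>k \<in> I\<close> would force \<open>u\<close> into the residual ideal and hence into \<open>p\<close>.
\<close>

lemma (in cring) boundary_drops_dimension:
  assumes I: "ideal I R" and s: "s \<in> carrier R" and b: "b \<in> carrier R"
    and chain: "has_chain (stratum R (boundary R I s b) s) n"
  shows "has_chain (stratum R I s) (Suc n)"
proof -
  let ?K = "boundary R I s b"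
  obtain Z where Z: "\<And>i. i \<le> n \<Longrightarrow> Z i \<in> stratum R ?K s" "\<And>i. i < n \<Longrightarrow> Z i \<subset> Z (Suc i)"
    using chain unfolding has_chain_def by blast
  define p where "p = Z 0"
  have p: "p \<in> stratum R ?K s" using Z(1) by (simp add: p_def)
  then interpret p: primeideal p R by (simp add: stratum_def Spec_def)
  have Kp: "residual R I s b \<subseteq> p" "b \<in> p"
    using p boundary_supersets[OF b, of I s] unfolding stratum_def by blast+
  have IK: "I \<subseteq> ?K"
  proof -
    have "I \<subseteq> residual R I s b"
      using b ideal.Icarr[OF I] ideal.I_r_closed[OF I]
      by (auto simp: residual_def stratum_def)
    then show ?thesis using boundary_supersets[OF b] by blast
  qed
  define S where "S = {u \<otimes> (b \<otimes> s) [^] k | u k. u \<in> carrier R - p \<and> k \<in> (UNIV::nat set)}"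
  have SI: "u \<otimes> (b \<otimes> s) [^] (k::nat) \<in> S" if "u \<in> carrier R" "u \<notin> p" for u k
    using that by (auto simp: S_def)
  have "I \<inter> S = {}"
  proof (rule ccontr)
    assume "I \<inter> S \<noteq> {}"
    then obtain u k where u: "u \<in> carrier R" "u \<notin> p" and uk: "u \<otimes> (b \<otimes> s) [^] (k::nat) \<in> I"
      by (auto simp: S_def)
    have "u \<otimes> b \<in> Q" if Q: "Q \<in> stratum R I s" for Q
    proof -
      interpret Q: primeideal Q R using Q by (simp add: stratum_def Spec_def)
      have "u \<in> Q \<or> (b \<otimes> s) [^] k \<in> Q"
        using uk Q Q.I_prime[of u "(b \<otimes> s) [^] k"] u b s by (auto simp: stratum_def)
      then have "u \<in> Q \<or> b \<otimes> s \<in> Q" using Q.nat_pow_in_prime b s by blast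
      then have "u \<in> Q \<or> b \<in> Q" using Q.I_prime b s Q by (auto simp: stratum_def)
      then show ?thesis using Q.I_l_closed Q.I_r_closed u b by blast
    qed
    then have "u \<in> residual R I s b" using u by (simp add: residual_def)
    then show False using Kp u by blast
  qed
  moreover have "S \<subseteq> carrier R" using b s by (auto simp: S_def)
  moreover have "\<one> \<in> S" using SI[of \<one> 0] p.one_notin by simp
  moreover have "x \<otimes> y \<in> S" if xy: "x \<in> S" "y \<in> S" for x y
  proof -
    obtain u k v l where u: "u \<in> carrier R" "u \<notin> p" and v: "v \<in> carrier R" "v \<notin> p"
      and x: "x = u \<otimes> (b \<otimes> s) [^] (k::nat)" and y: "y = v \<otimes> (b \<otimes> s) [^] (l::nat)"
      using xy unfolding S_def by blast
    have "x \<otimes> y = (u \<otimes> v) \<otimes> (b \<otimes> s) [^] (k + l)"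
      unfolding x y using u v b s by (simp add: nat_pow_mult[symmetric] m_ac)
    then show ?thesis using SI[of "u \<otimes> v"] u v p.I_prime by auto
  qed
  ultimately obtain q where q: "primeideal q R" "I \<subseteq> q" "q \<inter> S = {}"
    using prime_ideal_avoiding[OF I] by blast
  interpret q: primeideal q R by fact
  have "\<one> \<otimes> (b \<otimes> s) [^] (1::nat) \<in> S" using SI p.one_notin by blast
  then have bs: "b \<otimes> s \<notin> q" using q(3) b s by auto
  then have nq: "b \<notin> q" "s \<notin> q" using q.I_l_closed q.I_r_closed b s by blast+
  have qp: "q \<subseteq> p"
  proof
    fix u assume uq: "u \<in> q"
    show "u \<in> p"
    proof (rule ccontr)
      assume "u \<notin> p"
      then have "u \<in> S" using SI[of u 0] q.Icarr[OF uq] by simp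
      then show False using uq q(3) by blast
    qed
  qed
  define Z' where "Z' i = (case i of 0 \<Rightarrow> q | Suc j \<Rightarrow> Z j)" for i
  have "q \<in> stratum R I s" using q nq by (simp add: stratum_def Spec_def)
  moreover have "Z i \<in> stratum R I s" if "i \<le> n" for i
    using Z(1)[OF that] IK unfolding stratum_def by blast
  ultimately have "Z' i \<in> stratum R I s" if "i \<le> Suc n" for i
    using that by (cases i) (auto simp: Z'_def)
  moreover have "Z' i \<subset> Z' (Suc i)" if "i < Suc n" for i
    using that qp nq Kp Z(2) by (cases i) (auto simp: Z'_def p_def)
  ultimately show ?thesis unfolding has_chain_def by blast
qed

section \<open>Kronecker's theorem on strata of the spectrum\<close>

text \<open>
  Induction on \<open>n\<close>, passing to the boundary of the last element \<open>c = b\<^sub>n\<close>.  The induction hypothesis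
  makes a power of \<open>a s\<close> equal to \<open>v + u c + j\<close>, with \<open>v\<close> residual and \<open>j\<close> in the ideal generated by
  the elements \<open>b\<^sub>i + a x\<^sub>i\<close> found so far.  The choice \<open>x\<^sub>n = v\<close> works: \<open>v c\<close> vanishes on the stratum, so a
  prime \<open>Q\<close> of the stratum that contains \<open>c + a v\<close> contains \<open>a\<close> or both \<open>v\<close> and \<open>c\<close>; in the second
  case it contains the power of \<open>a s\<close>, hence \<open>a\<close>.
\<close>

lemma (in cring) kronecker_on_stratum:
  assumes "ideal I R" and s: "s \<in> carrier R" and a: "a \<in> carrier R"
    and "b \<in> {..<n} \<rightarrow> carrier R" and "\<not> has_chain (stratum R I s) n"
  shows "\<exists>x\<in>{..<n} \<rightarrow> carrier R.
    \<forall>Q\<in>stratum R I s. (\<forall>i<n. b i \<oplus> a \<otimes> x i \<in> Q) \<longrightarrow> a \<in> Q"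
  using assms(1,4,5)
proof (induction n arbitrary: I)
  case 0
  then have "stratum R I s = {}" unfolding has_chain_def by auto
  then show ?case by auto
next
  case (Suc n)
  let ?c = "b n" and ?K = "boundary R I s (b n)"
  have c: "?c \<in> carrier R" using Suc.prems by auto
  have bc: "b i \<in> carrier R" if "i < n" for i using Suc.prems(2) that by auto
  have "\<not> has_chain (stratum R ?K s) n"
    using boundary_drops_dimension Suc.prems(1,3) s c by blast
  moreover have "b \<in> {..<n} \<rightarrow> carrier R" using bc by auto
  ultimately have "\<exists>x\<in>{..<n} \<rightarrow> carrier R.
      \<forall>Q\<in>stratum R ?K s. (\<forall>i<n. b i \<oplus> a \<otimes> x i \<in> Q) \<longrightarrow> a \<in> Q"
    by (intro Suc.IH[OF boundary_ideal[OF c]])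
  then obtain x where x: "x \<in> {..<n} \<rightarrow> carrier R"
    and xK: "\<forall>Q\<in>stratum R ?K s. (\<forall>i<n. b i \<oplus> a \<otimes> x i \<in> Q) \<longrightarrow> a \<in> Q"
    by (rule bexE)
  have xc: "x i \<in> carrier R" if "i < n" for i using x that by auto
  define B where "B = {b i \<oplus> a \<otimes> x i | i. i < n}"
  have B: "B \<subseteq> carrier R" using bc xc a by (auto simp: B_def)
  let ?L = "?K <+>\<^bsub>R\<^esub> Idl B"
  have L: "ideal ?L R" using add_ideals boundary_ideal[OF c] genideal_ideal[OF B] by blast
  have KL: "?K \<subseteq> ?L"
  proof
    fix k assume k: "k \<in> ?K"
    have "k = k \<oplus> \<zero>" using ideal.Icarr[OF boundary_ideal[OF c] k] by simp
    then show "k \<in> ?L" unfolding set_add_def'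
      using k additive_subgroup.zero_closed[OF ideal.axioms(1)[OF genideal_ideal[OF B]]] by blast
  qed
  have BL: "B \<subseteq> ?L"
  proof
    fix k assume k: "k \<in> B"
    have "k = \<zero> \<oplus> k" using k B by auto
    then show "k \<in> ?L" unfolding set_add_def'
      using k genideal_self[OF B]
        additive_subgroup.zero_closed[OF ideal.axioms(1)[OF boundary_ideal[OF c]]] by blast
  qed
  \<comment> \<open>Otherwise a prime over \<open>?L\<close> avoids all powers of \<open>a s\<close>, against the choice of \<open>x\<close>.\<close>
  have "\<exists>N::nat. (a \<otimes> s) [^] N \<in> ?L"
  proof (rule ccontr)
    assume no: "\<not> ?thesis"
    define S where "S = range (\<lambda>N::nat. (a \<otimes> s) [^] N)"
    have as: "a \<otimes> s \<in> carrier R" using a s by simp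
    have "?L \<inter> S = {}" "S \<subseteq> carrier R" using no as by (auto simp: S_def)
    moreover have "\<one> \<in> S" unfolding S_def by (rule range_eqI[of _ _ 0]) simp
    moreover have "u \<otimes> v \<in> S" if uv: "u \<in> S" "v \<in> S" for u v
    proof -
      obtain i j :: nat where "u = (a \<otimes> s) [^] i" "v = (a \<otimes> s) [^] j"
        using uv by (auto simp: S_def)
      then have "u \<otimes> v = (a \<otimes> s) [^] (i + j)" using nat_pow_mult[OF as] by simp
      then show ?thesis by (simp add: S_def)
    qed
    ultimately obtain Q where Q: "primeideal Q R" "?L \<subseteq> Q" "Q \<inter> S = {}"
      using prime_ideal_avoiding[OF L] by blast
    interpret Q: primeideal Q R by fact
    have "(a \<otimes> s) [^] (1::nat) \<in> S" unfolding S_def by (rule rangeI)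
    then have "a \<otimes> s \<notin> Q" using Q(3) as by auto
    then have "a \<notin> Q" "s \<notin> Q" using Q.I_l_closed Q.I_r_closed a s by blast+
    moreover have "Q \<in> stratum R ?K s"
      using Q KL \<open>s \<notin> Q\<close> by (auto simp: stratum_def Spec_def)
    moreover have "\<forall>i<n. b i \<oplus> a \<otimes> x i \<in> Q" using BL Q(2) by (auto simp: B_def)
    ultimately show False using xK by blast
  qed
  then obtain N k j where k: "k \<in> ?K" and j: "j \<in> Idl B" and N: "(a \<otimes> s) [^] (N::nat) = k \<oplus> j"
    unfolding set_add_def' by blast
  obtain v u where v: "v \<in> residual R I s ?c" and u: "u \<in> carrier R" and kvu: "k = v \<oplus> u \<otimes> ?c"
    using k unfolding boundary_def set_add_def' cgenideal_def by blast
  have vc: "v \<in> carrier R" using v by (simp add: residual_def)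
  define x' where "x' = x(n := v)"
  have "a \<in> Q" if Q: "Q \<in> stratum R I s" and all: "\<forall>i<Suc n. b i \<oplus> a \<otimes> x' i \<in> Q" for Q
  proof -
    interpret Q: primeideal Q R using Q by (simp add: stratum_def Spec_def)
    have "B \<subseteq> Q"
    proof
      fix y assume "y \<in> B"
      then obtain i where "i < n" "y = b i \<oplus> a \<otimes> x i" unfolding B_def by blast
      then show "y \<in> Q" using all by (auto simp: x'_def dest: spec[of _ i])
    qed
    then have jQ: "j \<in> Q" using genideal_minimal[OF Q.is_ideal] j by blast
    have cv: "?c \<oplus> a \<otimes> v \<in> Q" using all by (auto simp: x'_def dest: spec[of _ n])
    have vcQ: "v \<otimes> ?c \<in> Q" using v Q by (simp add: residual_def)
    then have "v \<in> Q \<or> ?c \<in> Q" using Q.I_prime vc c by blast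
    then have "a \<in> Q \<or> (v \<in> Q \<and> ?c \<in> Q)"
    proof
      assume vQ: "v \<in> Q"
      have "?c = (?c \<oplus> a \<otimes> v) \<oplus> (\<ominus> a) \<otimes> v" using c a vc by algebra
      also have "\<dots> \<in> Q" by (rule Q.a_closed[OF _ Q.I_l_closed]) (use cv vQ a in auto)
      finally show ?thesis using vQ by blast
    next
      assume cQ: "?c \<in> Q"
      have "a \<otimes> v = (?c \<oplus> a \<otimes> v) \<oplus> (\<ominus> \<one>) \<otimes> ?c" using c a vc by algebra
      also have "\<dots> \<in> Q" by (rule Q.a_closed[OF _ Q.I_l_closed]) (use cv cQ in auto)
      finally show ?thesis using Q.I_prime a vc cQ by blast
    qed
    then show "a \<in> Q"
    proof
      assume vcb: "v \<in> Q \<and> ?c \<in> Q"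
      have "(a \<otimes> s) [^] N \<in> Q"
        
        unfolding N kvu
        by (rule Q.a_closed[OF Q.a_closed[OF _ Q.I_l_closed]]) (use vcb jQ u in auto)
      then have "a \<otimes> s \<in> Q" using Q.nat_pow_in_prime a s by blast
      then show "a \<in> Q" using Q.I_prime a s Q by (auto simp: stratum_def)
    qed
  qed
  moreover have "x' \<in> {..<Suc n} \<rightarrow> carrier R" using xc vc by (auto simp: x'_def less_Suc_eq)
  ultimately show ?case by (intro bexI[of _ x']) auto
qed

text \<open>
  The consequence of the dimension hypotheses from which both claims are derived.
\<close>

definition kronecker_range :: "('a, 'k) ring_scheme \<Rightarrow> nat \<Rightarrow> bool" where
  "kronecker_range R n \<longleftrightarrow> (\<forall>a\<in>carrier R. \<forall>b\<in>{..<n} \<rightarrow> carrier R. \<exists>x\<in>{..<n} \<rightarrow> carrier R.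
     \<forall>Q\<in>Spec R. (\<forall>i<n. b i \<oplus>\<^bsub>R\<^esub> a \<otimes>\<^bsub>R\<^esub> x i \<in> Q) \<longrightarrow> a \<in> Q)"

text \<open>
  Correct first on \<open>V(s)\<close>, then on \<open>D(s)\<close> with \<open>a s\<close> in place of \<open>a\<close>.  On \<open>D(s)\<close> a prime contains \<open>a\<close>
  if and only if it contains \<open>a s\<close>, and on \<open>V(s)\<close> the second correction, being a multiple of \<open>s\<close>,
  is invisible.
\<close>

lemma (in cring) kronecker_range_two_strata:
  assumes s: "s \<in> carrier R"
    and V: "\<not> has_chain (vanishing_set R s) n" and D: "\<not> has_chain (nonvanishing_set R s) n"
  shows "kronecker_range R n"
  unfolding kronecker_range_def
proof (intro ballI)
  fix a b assume a: "a \<in> carrier R" and b: "b \<in> {..<n} \<rightarrow> carrier R"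
  have V_eq: "vanishing_set R s = stratum R (PIdl s) \<one>"
  proof -
    have "PIdl s \<subseteq> Q \<and> \<one> \<notin> Q \<longleftrightarrow> s \<in> Q" if "Q \<in> Spec R" for Q
    proof -
      interpret Q: primeideal Q R using that by (simp add: Spec_def)
      show ?thesis using Q.one_notin cgenideal_self[OF s] cgenideal_minimal[OF Q.is_ideal] by blast
    qed
    then show ?thesis by (auto simp: vanishing_set_def stratum_def)
  qed
  have "\<exists>x\<in>{..<n} \<rightarrow> carrier R.
      \<forall>Q\<in>vanishing_set R s. (\<forall>i<n. b i \<oplus> a \<otimes> x i \<in> Q) \<longrightarrow> a \<in> Q"
    unfolding V_eq
    by (rule kronecker_on_stratum[OF cgenideal_ideal[OF s] one_closed a b V[unfolded V_eq]])
  then obtain x where x: "x \<in> {..<n} \<rightarrow> carrier R"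
    and xV: "\<forall>Q\<in>vanishing_set R s. (\<forall>i<n. b i \<oplus> a \<otimes> x i \<in> Q) \<longrightarrow> a \<in> Q"
    by (rule bexE)
  have D_eq: "nonvanishing_set R s = stratum R {\<zero>} s"
  proof -
    have "\<zero> \<in> Q" if "Q \<in> Spec R" for Q
      using that additive_subgroup.zero_closed[OF ideal.axioms(1)[OF primeideal.axioms(1)]]
      by (auto simp: Spec_def)
    then show ?thesis by (auto simp: nonvanishing_set_def vanishing_set_def stratum_def)
  qed
  have as: "a \<otimes> s \<in> carrier R" using a s by simp
  have b': "(\<lambda>i. b i \<oplus> a \<otimes> x i) \<in> {..<n} \<rightarrow> carrier R" using a b x by auto
  have "\<exists>y\<in>{..<n} \<rightarrow> carrier R. \<forall>Q\<in>nonvanishing_set R s.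
      (\<forall>i<n. (b i \<oplus> a \<otimes> x i) \<oplus> (a \<otimes> s) \<otimes> y i \<in> Q) \<longrightarrow> a \<otimes> s \<in> Q"
    unfolding D_eq by (rule kronecker_on_stratum[OF zeroideal s as b' D[unfolded D_eq]])
  then obtain y where y: "y \<in> {..<n} \<rightarrow> carrier R"
    and yD: "\<forall>Q\<in>nonvanishing_set R s.
      (\<forall>i<n. (b i \<oplus> a \<otimes> x i) \<oplus> (a \<otimes> s) \<otimes> y i \<in> Q) \<longrightarrow> a \<otimes> s \<in> Q"
    by (rule bexE)
  define z where "z i = x i \<oplus> s \<otimes> y i" for i
  have eq: "b i \<oplus> a \<otimes> z i = (b i \<oplus> a \<otimes> x i) \<oplus> (a \<otimes> s) \<otimes> y i"
    and carr: "b i \<in> carrier R" "x i \<in> carrier R" "y i \<in> carrier R" if "i < n" for i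
  proof -
    show c: "b i \<in> carrier R" "x i \<in> carrier R" "y i \<in> carrier R" using that b x y by auto
    show "b i \<oplus> a \<otimes> z i = (b i \<oplus> a \<otimes> x i) \<oplus> (a \<otimes> s) \<otimes> y i"
      unfolding z_def using c a s by algebra
  qed
  have "a \<in> Q" if Q: "Q \<in> Spec R" and all: "\<forall>i<n. b i \<oplus> a \<otimes> z i \<in> Q" for Q
  proof -
    interpret Q: primeideal Q R using Q by (simp add: Spec_def)
    show ?thesis
    proof (cases "s \<in> Q")
      case True
      have "b i \<oplus> a \<otimes> x i \<in> Q" if i: "i < n" for i
      proof -
        note c = carr[OF i] a s
        have "b i \<oplus> a \<otimes> x i = (b i \<oplus> a \<otimes> z i) \<oplus> (\<ominus> (a \<otimes> y i)) \<otimes> s"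
          unfolding eq[OF i] using c by algebra
        also have "\<dots> \<in> Q"
          by (rule Q.a_closed[OF _ Q.I_l_closed]) (use all i c True in auto)
        finally show ?thesis .
      qed
      then show ?thesis using xV Q True by (simp add: vanishing_set_def)
    next
      case False
      then have "a \<otimes> s \<in> Q"
        using bspec[OF yD, of Q] Q all eq by (simp add: nonvanishing_set_def vanishing_set_def)
      then show ?thesis using Q.I_prime a s False by blast
    qed
  qed
  moreover have "z \<in> {..<n} \<rightarrow> carrier R" using carr s by (auto simp: z_def)
  ultimately show "\<exists>x\<in>{..<n} \<rightarrow> carrier R.
      \<forall>Q\<in>Spec R. (\<forall>i<n. b i \<oplus> a \<otimes> x i \<in> Q) \<longrightarrow> a \<in> Q" by (intro bexI[of _ z]) auto
qed

section \<open>Linear forms\<close>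

abbreviation dual ::
  "('a, 'k) ring_scheme \<Rightarrow> ('a, 'b, 'm) module_scheme \<Rightarrow> ('b \<Rightarrow> 'a) set" where
  "dual R M \<equiv> module_hom R M (regular_module R)"

lemma module_homD:
  assumes "f \<in> module_hom R M N"
  shows module_hom_closed: "x \<in> carrier M \<Longrightarrow> f x \<in> carrier N"
    and module_hom_add: "x \<in> carrier M \<Longrightarrow> y \<in> carrier M \<Longrightarrow> f (x \<oplus>\<^bsub>M\<^esub> y) = f x \<oplus>\<^bsub>N\<^esub> f y"
    and module_hom_smult: "a \<in> carrier R \<Longrightarrow> x \<in> carrier M \<Longrightarrow> f (a \<odot>\<^bsub>M\<^esub> x) = a \<odot>\<^bsub>N\<^esub> f x"
  using assms by (auto simp: module_hom_def)

lemma module_homI: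
  assumes "\<And>x. x \<in> carrier M \<Longrightarrow> f x \<in> carrier N"
    and "\<And>x y. x \<in> carrier M \<Longrightarrow> y \<in> carrier M \<Longrightarrow> f (x \<oplus>\<^bsub>M\<^esub> y) = f x \<oplus>\<^bsub>N\<^esub> f y"
    and "\<And>a x. a \<in> carrier R \<Longrightarrow> x \<in> carrier M \<Longrightarrow> f (a \<odot>\<^bsub>M\<^esub> x) = a \<odot>\<^bsub>N\<^esub> f x"
  shows "f \<in> module_hom R M N"
  using assms by (auto simp: module_hom_def)

lemma (in cring) regular_module_module: "Module.module R (regular_module R)"
  by (intro moduleI abelian_groupI is_cring)
    (auto simp: regular_module_def m_assoc l_distr r_distr a_ac intro!: bexI[of _ "\<ominus> _"] l_neg)

lemma (in Module.module) dual_closed [simp]: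
  "\<phi> \<in> dual R M \<Longrightarrow> x \<in> carrier M \<Longrightarrow> \<phi> x \<in> carrier R"
  using module_hom_closed[of \<phi> R M "regular_module R" x] by (simp add: regular_module_def)

lemma (in Module.module) dual_add:
  "\<phi> \<in> dual R M \<Longrightarrow> x \<in> carrier M \<Longrightarrow> y \<in> carrier M \<Longrightarrow> \<phi> (x \<oplus>\<^bsub>M\<^esub> y) = \<phi> x \<oplus> \<phi> y"
  using module_hom_add[of \<phi> R M "regular_module R" x y] by (simp add: regular_module_def)

lemma (in Module.module) dual_smult:
  "\<phi> \<in> dual R M \<Longrightarrow> a \<in> carrier R \<Longrightarrow> x \<in> carrier M \<Longrightarrow> \<phi> (a \<odot>\<^bsub>M\<^esub> x) = a \<otimes> \<phi> x"
  using module_hom_smult[of \<phi> R M "regular_module R" a x] by (simp add: regular_module_def)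

lemma (in Module.module) dualI:
  assumes "\<And>x. x \<in> carrier M \<Longrightarrow> f x \<in> carrier R"
    and "\<And>x y. x \<in> carrier M \<Longrightarrow> y \<in> carrier M \<Longrightarrow> f (x \<oplus>\<^bsub>M\<^esub> y) = f x \<oplus> f y"
    and "\<And>a x. a \<in> carrier R \<Longrightarrow> x \<in> carrier M \<Longrightarrow> f (a \<odot>\<^bsub>M\<^esub> x) = a \<otimes> f x"
  shows "f \<in> dual R M"
  by (rule module_homI) (use assms in \<open>auto simp: regular_module_def\<close>)

lemma (in Module.module) dual_zero_form: "(\<lambda>x. \<zero>) \<in> dual R M"
  by (rule dualI) auto

lemma (in Module.module) dual_scale:
  assumes "\<phi> \<in> dual R M" "a \<in> carrier R"
  shows "(\<lambda>x. a \<otimes> \<phi> x) \<in> dual R M"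
  by (rule dualI) (use assms in \<open>auto simp: dual_add dual_smult r_distr m_lcomm\<close>)

lemma (in Module.module) dual_plus:
  assumes "\<phi> \<in> dual R M" "\<psi> \<in> dual R M"
  shows "(\<lambda>x. \<phi> x \<oplus> \<psi> x) \<in> dual R M"
  by (rule dualI) (use assms in \<open>auto simp: dual_add dual_smult r_distr R.a_ac\<close>)

lemma (in Module.module) dual_linear_combination:
  assumes "finite A" "\<And>k. k \<in> A \<Longrightarrow> \<phi> k \<in> dual R M" "\<And>k. k \<in> A \<Longrightarrow> a k \<in> carrier R"
  shows "(\<lambda>x. \<Oplus>k\<in>A. a k \<otimes> \<phi> k x) \<in> dual R M"
proof (rule dualI)
  have c: "(\<lambda>k. a k \<otimes> \<phi> k x) \<in> A \<rightarrow> carrier R" if "x \<in> carrier M" for x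
    using assms that by auto
  show "(\<Oplus>k\<in>A. a k \<otimes> \<phi> k x) \<in> carrier R" if "x \<in> carrier M" for x
    using c[OF that] by (rule R.finsum_closed)
  show "(\<Oplus>k\<in>A. a k \<otimes> \<phi> k (x \<oplus>\<^bsub>M\<^esub> y)) = (\<Oplus>k\<in>A. a k \<otimes> \<phi> k x) \<oplus> (\<Oplus>k\<in>A. a k \<otimes> \<phi> k y)"
    if xy: "x \<in> carrier M" "y \<in> carrier M" for x y
  proof -
    have "(\<Oplus>k\<in>A. a k \<otimes> \<phi> k (x \<oplus>\<^bsub>M\<^esub> y)) = (\<Oplus>k\<in>A. a k \<otimes> \<phi> k x \<oplus> a k \<otimes> \<phi> k y)"
      by (rule R.finsum_cong') (use assms xy in \<open>auto simp: dual_add r_distr\<close>)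
    also have "\<dots> = (\<Oplus>k\<in>A. a k \<otimes> \<phi> k x) \<oplus> (\<Oplus>k\<in>A. a k \<otimes> \<phi> k y)"
      using c xy by (intro R.finsum_addf)
    finally show ?thesis .
  qed
  show "(\<Oplus>k\<in>A. a k \<otimes> \<phi> k (b \<odot>\<^bsub>M\<^esub> x)) = b \<otimes> (\<Oplus>k\<in>A. a k \<otimes> \<phi> k x)"
    if bx: "b \<in> carrier R" "x \<in> carrier M" for b x
  proof -
    have "(\<Oplus>k\<in>A. a k \<otimes> \<phi> k (b \<odot>\<^bsub>M\<^esub> x)) = (\<Oplus>k\<in>A. b \<otimes> (a k \<otimes> \<phi> k x))"
      by (rule R.finsum_cong') (use assms bx in \<open>auto simp: dual_smult m_lcomm\<close>)
    also have "\<dots> = b \<otimes> (\<Oplus>k\<in>A. a k \<otimes> \<phi> k x)"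
      using finsum_rdistr[OF assms(1) bx(1) c[OF bx(2)]] by simp
    finally show ?thesis .
  qed
qed

lemma module_hom_zero:
  assumes M: "Module.module R M" and N: "Module.module R N" and f: "f \<in> module_hom R M N"
  shows "f \<zero>\<^bsub>M\<^esub> = \<zero>\<^bsub>N\<^esub>"
proof -
  interpret M: Module.module R M by fact
  interpret N: Module.module R N by fact
  have "f (\<zero>\<^bsub>R\<^esub> \<odot>\<^bsub>M\<^esub> \<zero>\<^bsub>M\<^esub>) = \<zero>\<^bsub>R\<^esub> \<odot>\<^bsub>N\<^esub> f \<zero>\<^bsub>M\<^esub>"
    using f by (intro module_hom_smult) auto
  then show ?thesis using module_hom_closed[OF f, of "\<zero>\<^bsub>M\<^esub>"] by simp
qed

lemma (in Module.module) dual_finsum: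
  assumes "\<phi> \<in> dual R M" "g \<in> A \<rightarrow> carrier M" "finite A"
  shows "\<phi> (\<Oplus>\<^bsub>M\<^esub>k\<in>A. g k) = (\<Oplus>k\<in>A. \<phi> (g k))"
  using assms(3,2)
proof (induction A)
  case empty
  then show ?case
    using module_hom_zero[OF module_axioms regular_module_module assms(1)]
    by (simp add: regular_module_def)
next
  case (insert k A)
  then have "(\<lambda>k. \<phi> (g k)) \<in> A \<rightarrow> carrier R" "\<phi> (g k) \<in> carrier R"
    using assms(1) by (auto simp: Pi_iff)
  with insert show ?case using dual_add[OF assms(1), of "g k" "\<Oplus>\<^bsub>M\<^esub>k\<in>A. g k"] by simp
qed

lemma (in Module.module) submodule_finsum:
  assumes N: "submodule N R M" and "g \<in> A \<rightarrow> N" "finite A"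
  shows "(\<Oplus>\<^bsub>M\<^esub>k\<in>A. g k) \<in> N"
  using assms(3,2)
proof (induction A)
  case empty
  interpret N: submodule N R M by fact
  show ?case using N.one_closed by simp
next
  case (insert k A)
  then have "g \<in> A \<rightarrow> carrier M" "g k \<in> carrier M" using submoduleE(1)[OF N] by auto
  with insert show ?case using submoduleE(5)[OF N] by auto
qed

section \<open>Unimodular elements and primes\<close>

text \<open>
  For projective \<open>M\<close> this says \<open>p \<in> Q M\<close>.  In terms of the order ideal of \<open>p\<close>, the ideal of all
  values of linear forms at \<open>p\<close>, it says that \<open>Q\<close> contains the order ideal.
\<close>

definition vanishes_at ::
  "('a, 'k) ring_scheme \<Rightarrow> ('a, 'b, 'm) module_scheme \<Rightarrow> 'a set \<Rightarrow> 'b \<Rightarrow> bool" where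
  "vanishes_at R M Q p \<longleftrightarrow> (\<forall>\<phi>\<in>dual R M. \<phi> p \<in> Q)"

lemma (in cring) proper_ideal_in_prime:
  assumes "ideal I R" "\<one> \<notin> I"
  shows "\<exists>Q\<in>Spec R. I \<subseteq> Q"
proof -
  obtain Q where "primeideal Q R" "I \<subseteq> Q"
    using prime_ideal_avoiding[OF assms(1), of "{\<one>}"] assms(2) by auto
  then show ?thesis by (auto simp: Spec_def)
qed

lemma (in Module.module) order_ideal:
  assumes "p \<in> carrier M"
  shows "ideal {\<phi> p | \<phi>. \<phi> \<in> dual R M} R"
proof (rule idealI[OF R.ring_axioms])
  let ?O = "{\<phi> p | \<phi>. \<phi> \<in> dual R M}"
  have scale: "a \<otimes> x \<in> ?O" if x: "x \<in> ?O" and a: "a \<in> carrier R" for a x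
  proof -
    obtain \<phi> where \<phi>: "\<phi> \<in> dual R M" "x = \<phi> p" using x by auto
    show ?thesis
      unfolding \<phi>(2) mem_Collect_eq
      by (rule exI[of _ "\<lambda>x. a \<otimes> \<phi> x"]) (simp add: dual_scale[OF \<phi>(1) a])
  qed
  have carr: "?O \<subseteq> carrier R" using assms by auto
  show "subgroup ?O (add_monoid R)"
  proof (rule R.add.subgroupI)
    show "?O \<subseteq> carrier R" by fact
    show "?O \<noteq> {}" using dual_zero_form by auto
    show "\<ominus> x \<in> ?O" if "x \<in> ?O" for x
    proof -
      have "\<ominus> x = (\<ominus> \<one>) \<otimes> x" using carr that by (simp add: l_minus subset_iff)
      then show ?thesis using scale[OF that, of "\<ominus> \<one>"] by simp
    qed
    show "x \<oplus> y \<in> ?O" if xy: "x \<in> ?O" "y \<in> ?O" for x y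
    proof -
      obtain \<phi> \<psi> where \<phi>: "\<phi> \<in> dual R M" "x = \<phi> p" and \<psi>: "\<psi> \<in> dual R M" "y = \<psi> p"
        using xy by auto
      show ?thesis
        unfolding \<phi>(2) \<psi>(2) mem_Collect_eq
        by (rule exI[of _ "\<lambda>x. \<phi> x \<oplus> \<psi> x"]) (simp add: dual_plus[OF \<phi>(1) \<psi>(1)])
    qed
  qed
  fix x a assume x: "x \<in> ?O" and a: "a \<in> carrier R"
  show "a \<otimes> x \<in> ?O" using scale x a .
  moreover have "x \<otimes> a = a \<otimes> x" using carr x a by (auto intro: m_comm)
  ultimately show "x \<otimes> a \<in> ?O" by simp
qed

lemma (in Module.module) unimodular_if_vanishes_nowhere:
  assumes "p \<in> carrier M" and "\<And>Q. Q \<in> Spec R \<Longrightarrow> \<not> vanishes_at R M Q p"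
  shows "unimodular R M p"
proof -
  have "\<one> \<in> {\<phi> p | \<phi>. \<phi> \<in> dual R M}"
  proof (rule ccontr)
    assume "\<one> \<notin> {\<phi> p | \<phi>. \<phi> \<in> dual R M}"
    then obtain Q where "Q \<in> Spec R" "{\<phi> p | \<phi>. \<phi> \<in> dual R M} \<subseteq> Q"
      using R.proper_ideal_in_prime[OF order_ideal[OF assms(1)]] by auto
    then have "vanishes_at R M Q p" by (auto simp: vanishes_at_def)
    then show False using assms(2) \<open>Q \<in> Spec R\<close> by simp
  qed
  then obtain \<phi> where "\<phi> \<in> dual R M" "\<phi> p = \<one>" by auto
  then show ?thesis using assms(1) by (auto simp: unimodular_def)
qed

section \<open>Frames and unimodular elements in a coset\<close>

text \<open>
  The elements \<open>x\<^sub>i\<close> are required to lie in a given set \<open>N\<close>, the set of directions in which an element is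
  going to be moved.  After inverting \<open>\<delta>\<close>, a frame spans a free direct summand of rank \<open>n\<close>.
\<close>

definition frame ::
  "('a, 'k) ring_scheme \<Rightarrow> ('a, 'b, 'm) module_scheme \<Rightarrow> 'b set \<Rightarrow> nat \<Rightarrow> 'a \<Rightarrow> bool" where
  "frame R M N n \<delta> \<longleftrightarrow> (\<exists>\<phi> x. \<forall>i<n. \<phi> i \<in> dual R M \<and> x i \<in> N \<and>
     (\<forall>j<n. \<phi> i (x j) = (if i = j then \<delta> else \<zero>\<^bsub>R\<^esub>)))"

text \<open>
  With \<open>q = \<delta> \<Sum> y\<^sub>j x\<^sub>j\<close> the frame property gives \<open>\<phi>\<^sub>i(p + q) = \<phi>\<^sub>i(p) + \<delta>\<^sup>2 y\<^sub>i\<close>, so the Kronecker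
  property for \<open>a = \<delta>\<^sup>2\<close> puts \<open>\<delta>\<close> into every prime at which \<open>p + q\<close> vanishes.  The spare factor
  \<open>\<delta>\<close> in \<open>q\<close> is what makes \<open>p\<close> and \<open>p + q\<close> agree at such a prime.
\<close>

lemma (in Module.module) absorb_frame:
  assumes K: "kronecker_range R n" and N: "submodule N R M" and p: "p \<in> carrier M"
    and \<delta>: "\<delta> \<in> carrier R" and fr: "frame R M N n \<delta>"
  shows "\<exists>q\<in>N. \<forall>Q\<in>Spec R. vanishes_at R M Q (p \<oplus>\<^bsub>M\<^esub> q) \<longrightarrow> vanishes_at R M Q p \<and> \<delta> \<in> Q"
proof -
  obtain \<phi> x where \<phi>: "\<And>i. i < n \<Longrightarrow> \<phi> i \<in> dual R M" and xN: "\<And>i. i < n \<Longrightarrow> x i \<in> N"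
    and \<phi>x: "\<And>i j. i < n \<Longrightarrow> j < n \<Longrightarrow> \<phi> i (x j) = (if i = j then \<delta> else \<zero>)"
    using fr unfolding frame_def by metis
  have x: "x i \<in> carrier M" if "i < n" for i using xN[OF that] submoduleE(1)[OF N] by auto
  define b where "b i = \<phi> i p" for i
  have "b \<in> {..<n} \<rightarrow> carrier R" using \<phi> p by (auto simp: b_def)
  moreover have "\<delta> \<otimes> \<delta> \<in> carrier R" using \<delta> by simp
  ultimately obtain y where y: "y \<in> {..<n} \<rightarrow> carrier R" and
    kron: "\<forall>Q\<in>Spec R. (\<forall>i<n. b i \<oplus> (\<delta> \<otimes> \<delta>) \<otimes> y i \<in> Q) \<longrightarrow> \<delta> \<otimes> \<delta> \<in> Q"
    using K unfolding kronecker_range_def by metis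
  have yc: "y i \<in> carrier R" if "i < n" for i using y that by auto
  define q' where "q' = (\<Oplus>\<^bsub>M\<^esub>j\<in>{..<n}. y j \<odot>\<^bsub>M\<^esub> x j)"
  define q where "q = \<delta> \<odot>\<^bsub>M\<^esub> q'"
  have q'N: "q' \<in> N" unfolding q'_def
    by (rule submodule_finsum[OF N]) (use yc xN submoduleE(4)[OF N] in auto)
  then have q': "q' \<in> carrier M" using submoduleE(1)[OF N] by auto
  have qN: "q \<in> N" unfolding q_def using submoduleE(4)[OF N \<delta> q'N] .
  have q: "q \<in> carrier M" using q' \<delta> by (simp add: q_def)
  have \<phi>q: "\<phi> i q = (\<delta> \<otimes> \<delta>) \<otimes> y i" if i: "i < n" for i
  proof -
    have "\<phi> i q' = (\<Oplus>j\<in>{..<n}. \<phi> i (y j \<odot>\<^bsub>M\<^esub> x j))"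
      unfolding q'_def by (rule dual_finsum) (use \<phi> i yc x in auto)
    also have "\<dots> = (\<Oplus>j\<in>{..<n}. if i = j then y j \<otimes> \<delta> else \<zero>)"
      by (rule R.finsum_cong') (use \<phi> i yc x \<phi>x \<delta> in \<open>auto simp: dual_smult\<close>)
    also have "\<dots> = y i \<otimes> \<delta>"
      by (rule R.finsum_singleton) (use i yc \<delta> in auto)
    finally have "\<phi> i q = \<delta> \<otimes> (y i \<otimes> \<delta>)"
      unfolding q_def using dual_smult[OF \<phi>[OF i] \<delta> q'] by simp
    then show ?thesis using \<delta> yc[OF i] by (simp add: m_ac)
  qed
  have "vanishes_at R M Q p \<and> \<delta> \<in> Q"
    if Q: "Q \<in> Spec R" and van: "vanishes_at R M Q (p \<oplus>\<^bsub>M\<^esub> q)" for Q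
  proof -
    interpret Q: primeideal Q R using Q by (simp add: Spec_def)
    have "b i \<oplus> (\<delta> \<otimes> \<delta>) \<otimes> y i \<in> Q" if i: "i < n" for i
      using van \<phi>[OF i] dual_add[OF \<phi>[OF i] p q] \<phi>q[OF i]
      by (auto simp: vanishes_at_def b_def)
    then have "\<delta> \<otimes> \<delta> \<in> Q" using kron Q by auto
    then have \<delta>Q: "\<delta> \<in> Q" using Q.I_prime[OF \<delta> \<delta>] by blast
    have "\<psi> p \<in> Q" if \<psi>: "\<psi> \<in> dual R M" for \<psi>
    proof (rule Q.add_mem_cancel)
      show "\<psi> p \<oplus> \<delta> \<otimes> \<psi> q' \<in> Q"
        using van \<psi> dual_add[OF \<psi> p q] dual_smult[OF \<psi> \<delta> q']
        by (auto simp: vanishes_at_def q_def)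
      show "\<delta> \<otimes> \<psi> q' \<in> Q" using \<delta>Q \<psi> q' by (simp add: Q.I_r_closed)
      show "\<psi> p \<in> carrier R" using \<psi> p by simp
    qed
    with \<delta>Q show ?thesis by (simp add: vanishes_at_def)
  qed
  with qN show ?thesis by (intro bexI[of _ q]) auto
qed

text \<open>
  Call \<open>c\<close> absorbable if any correction \<open>q\<close> of \<open>p\<close> can be replaced by a correction \<open>q'\<close> such that every
  prime at which \<open>p + q'\<close> vanishes contains \<open>c\<close> and is one at which \<open>p + q\<close> vanishes; only corrections
  that create no new zeros of \<open>p\<close> are considered.  Absorbing one element after another shows that the
  absorbable elements form an ideal, without any bookkeeping of finite families.  It contains the
  \<open>\<delta>\<close> of every frame in \<open>N\<close> and, trivially, all values of linear forms at \<open>p\<close>, so by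
  hypothesis it lies in no prime.
\<close>

lemma (in Module.module) unimodular_in_coset:
  assumes K: "kronecker_range R n" and N: "submodule N R M" and p: "p \<in> carrier M"
    and fr: "\<And>Q. Q \<in> Spec R \<Longrightarrow> vanishes_at R M Q p \<Longrightarrow> \<exists>\<delta>\<in>carrier R - Q. frame R M N n \<delta>"
  shows "\<exists>q\<in>N. unimodular R M (p \<oplus>\<^bsub>M\<^esub> q)"
proof -
  have NM: "\<And>q. q \<in> N \<Longrightarrow> q \<in> carrier M" using submoduleE(1)[OF N] by auto
  \<comment> \<open>\<open>G\<close>: admissible corrections; \<open>ok c q q'\<close>: passing from \<open>q\<close> to \<open>q'\<close> absorbs \<open>c\<close>;
    \<open>J\<close>: absorbable elements\<close>
  define G where "G = {q \<in> N. \<forall>Q\<in>Spec R. vanishes_at R M Q (p \<oplus>\<^bsub>M\<^esub> q) \<longrightarrow> vanishes_at R M Q p}"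
  define ok where "ok c q q' \<longleftrightarrow> q' \<in> G \<and> (\<forall>Q\<in>Spec R. vanishes_at R M Q (p \<oplus>\<^bsub>M\<^esub> q') \<longrightarrow>
      vanishes_at R M Q (p \<oplus>\<^bsub>M\<^esub> q) \<and> c \<in> Q)" for c q q'
  define J where "J = {c \<in> carrier R. \<forall>q\<in>G. \<exists>q'. ok c q q'}"
  have prQ: "ideal Q R" if "Q \<in> Spec R" for Q
    using that primeideal.axioms(1) by (auto simp: Spec_def)
  have scale: "a \<otimes> c \<in> J" if c: "c \<in> J" and a: "a \<in> carrier R" for a c
  proof -
    have "\<exists>q'. ok (a \<otimes> c) q q'" if q: "q \<in> G" for q
    proof -
      obtain q' where "ok c q q'" using c q by (auto simp: J_def)
      then have "ok (a \<otimes> c) q q'"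
        using ideal.I_l_closed[OF prQ _ a] by (auto simp: ok_def)
      then show ?thesis ..
    qed
    then show ?thesis using c a by (simp add: J_def)
  qed
  have plus: "c \<oplus> c' \<in> J" if c: "c \<in> J" and c': "c' \<in> J" for c c'
  proof -
    have "\<exists>q'. ok (c \<oplus> c') q q'" if q: "q \<in> G" for q
    proof -
      obtain q1 where q1: "ok c q q1" using c q by (auto simp: J_def)
      then have "q1 \<in> G" by (simp add: ok_def)
      then obtain q2 where q2: "ok c' q1 q2" using c' by (auto simp: J_def)
      have "ok (c \<oplus> c') q q2"
        using q1 q2 additive_subgroup.a_closed[OF ideal.axioms(1)[OF prQ]]
        by (auto simp: ok_def)
      then show ?thesis ..
    qed
    then show ?thesis using c c' by (simp add: J_def)
  qed
  have order: "\<phi> p \<in> J" if \<phi>: "\<phi> \<in> dual R M" for \<phi>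
  proof -
    have "ok (\<phi> p) q q" if "q \<in> G" for q
      using that \<phi> by (auto simp: ok_def G_def vanishes_at_def)
    then show ?thesis using \<phi> p by (auto simp: J_def)
  qed
  have J: "ideal J R"
  proof (rule idealI[OF R.ring_axioms])
    have sub: "J \<subseteq> carrier R" by (auto simp: J_def)
    show "subgroup J (add_monoid R)"
    proof (rule R.add.subgroupI)
      show "J \<subseteq> carrier R" by fact
      show "J \<noteq> {}" using order[OF dual_zero_form] by auto
      show "\<ominus> c \<in> J" if "c \<in> J" for c
      proof -
        have "\<ominus> c = (\<ominus> \<one>) \<otimes> c" using sub that by (simp add: l_minus subset_iff)
        then show ?thesis using scale[OF that, of "\<ominus> \<one>"] by simp
      qed
    qed (rule plus)
    fix c a assume c: "c \<in> J" and a: "a \<in> carrier R"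
    show "a \<otimes> c \<in> J" using scale c a .
    moreover have "c \<otimes> a = a \<otimes> c" using sub c a by (auto intro: m_comm)
    ultimately show "c \<otimes> a \<in> J" by simp
  qed
  have frJ: "\<delta> \<in> J" if \<delta>: "\<delta> \<in> carrier R" and f: "frame R M N n \<delta>" for \<delta>
  proof -
    have "\<exists>q'. ok \<delta> q q'" if q: "q \<in> G" for q
    proof -
      have qN: "q \<in> N" using q by (simp add: G_def)
      have pq: "p \<oplus>\<^bsub>M\<^esub> q \<in> carrier M" using p NM[OF qN] by simp
      obtain q1 where q1: "q1 \<in> N" and *: "\<forall>Q\<in>Spec R. vanishes_at R M Q ((p \<oplus>\<^bsub>M\<^esub> q) \<oplus>\<^bsub>M\<^esub> q1)
          \<longrightarrow> vanishes_at R M Q (p \<oplus>\<^bsub>M\<^esub> q) \<and> \<delta> \<in> Q"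
        using absorb_frame[OF K N pq \<delta> f] by (rule bexE)
      have eq: "(p \<oplus>\<^bsub>M\<^esub> q) \<oplus>\<^bsub>M\<^esub> q1 = p \<oplus>\<^bsub>M\<^esub> (q \<oplus>\<^bsub>M\<^esub> q1)"
        using p NM[OF qN] NM[OF q1] by (rule M.a_assoc)
      have "q \<oplus>\<^bsub>M\<^esub> q1 \<in> N" using submoduleE(5)[OF N qN q1] .
      then have "ok \<delta> q (q \<oplus>\<^bsub>M\<^esub> q1)"
        using q * unfolding eq by (auto simp: ok_def G_def)
      then show ?thesis ..
    qed
    then show ?thesis using \<delta> by (simp add: J_def)
  qed
  have "\<one> \<in> J"
  proof (rule ccontr)
    assume "\<one> \<notin> J"
    then obtain Q where Q: "Q \<in> Spec R" "J \<subseteq> Q" using R.proper_ideal_in_prime[OF J] by auto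
    have "vanishes_at R M Q p" using order Q(2) by (auto simp: vanishes_at_def)
    then obtain \<delta> where "\<delta> \<in> carrier R - Q" "frame R M N n \<delta>" using fr Q(1) by auto
    then show False using frJ Q(2) by auto
  qed
  moreover have "\<zero>\<^bsub>M\<^esub> \<in> G"
  proof -
    interpret N: submodule N R M by fact
    show ?thesis using N.one_closed p by (simp add: G_def)
  qed
  ultimately obtain q where q: "ok \<one> \<zero>\<^bsub>M\<^esub> q" by (auto simp: J_def)
  then have qN: "q \<in> N" by (simp add: ok_def G_def)
  have "unimodular R M (p \<oplus>\<^bsub>M\<^esub> q)"
  proof (rule unimodular_if_vanishes_nowhere)
    show "p \<oplus>\<^bsub>M\<^esub> q \<in> carrier M" using p NM[OF qN] by simp
    show "\<not> vanishes_at R M Q (p \<oplus>\<^bsub>M\<^esub> q)" if "Q \<in> Spec R" for Q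
      using that q primeideal.one_notin[of Q R] by (auto simp: ok_def Spec_def)
  qed
  then show ?thesis using qN by auto
qed

text \<open>
  Write \<open>x\<^sub>j = a\<^sub>j p + q\<^sub>j\<close>.  The matrix \<open>\<phi>\<^sub>i(q\<^sub>j)\<close> is \<open>\<delta>\<close> times the identity minus the rank one matrix
  \<open>b\<^sub>i a\<^sub>j\<close>, where \<open>b\<^sub>i = \<phi>\<^sub>i(p)\<close>.  The Sherman--Morrison formula inverts it up to the factor \<open>w \<delta>\<close> with
  \<open>w = \<delta> - \<Sum> a\<^sub>k b\<^sub>k\<close>; this factor is not in \<open>Q\<close> because \<open>\<delta>\<close> is not and all \<open>b\<^sub>k\<close> are.
\<close>

lemma (in Module.module) frame_in_complement:
  assumes Q: "Q \<in> Spec R" and p: "p \<in> carrier M" and P1: "submodule P1 R M"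
    and span: "carrier M = {(a \<odot>\<^bsub>M\<^esub> p) \<oplus>\<^bsub>M\<^esub> q | a q. a \<in> carrier R \<and> q \<in> P1}"
    and van: "vanishes_at R M Q p"
    and \<delta>: "\<delta> \<in> carrier R - Q" and fr: "frame R M (carrier M) n \<delta>"
  shows "\<exists>\<delta>'\<in>carrier R - Q. frame R M P1 n \<delta>'"
proof -
  interpret Q: primeideal Q R using Q by (simp add: Spec_def)
  have \<delta>c: "\<delta> \<in> carrier R" using \<delta> by simp
  obtain \<phi> x where \<phi>: "\<And>i. i < n \<Longrightarrow> \<phi> i \<in> dual R M"
    and x: "\<And>i. i < n \<Longrightarrow> x i \<in> carrier M"
    and \<phi>x: "\<And>i j. i < n \<Longrightarrow> j < n \<Longrightarrow> \<phi> i (x j) = (if i = j then \<delta> else \<zero>)"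
    using fr unfolding frame_def by metis
  have "\<exists>a q. a \<in> carrier R \<and> q \<in> P1 \<and> x j = (a \<odot>\<^bsub>M\<^esub> p) \<oplus>\<^bsub>M\<^esub> q" if "j < n" for j
    using x[OF that] span by auto
  then obtain a q where a: "\<And>j. j < n \<Longrightarrow> a j \<in> carrier R" and qP: "\<And>j. j < n \<Longrightarrow> q j \<in> P1"
    and xq: "\<And>j. j < n \<Longrightarrow> x j = (a j \<odot>\<^bsub>M\<^esub> p) \<oplus>\<^bsub>M\<^esub> q j" by metis
  have q: "q j \<in> carrier M" if "j < n" for j using qP[OF that] submoduleE(1)[OF P1] by auto
  define b where "b i = \<phi> i p" for i
  have b: "b i \<in> carrier R" "b i \<in> Q" if "i < n" for i
    using \<phi>[OF that] p van by (auto simp: b_def vanishes_at_def)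
  have form_q: "\<psi> (q j) = \<psi> (x j) \<ominus> a j \<otimes> \<psi> p" if \<psi>: "\<psi> \<in> dual R M" and j: "j < n" for \<psi> j
  proof -
    have "\<psi> (x j) = a j \<otimes> \<psi> p \<oplus> \<psi> (q j)"
      using xq[OF j] a[OF j] p q[OF j] \<psi> by (simp add: dual_add dual_smult)
    moreover have "a j \<otimes> \<psi> p \<oplus> \<psi> (q j) \<ominus> a j \<otimes> \<psi> p = \<psi> (q j)"
      using dual_closed[OF \<psi> p] dual_closed[OF \<psi> q[OF j]] a[OF j] by algebra
    ultimately show ?thesis by simp
  qed
  define \<Psi> where "\<Psi> z = (\<Oplus>k\<in>{..<n}. a k \<otimes> \<phi> k z)" for z
  have \<Psi>: "\<Psi> \<in> dual R M"
    unfolding \<Psi>_def by (rule dual_linear_combination) (use \<phi> a in auto)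
  have \<Psi>p: "\<Psi> p \<in> Q"
    unfolding \<Psi>_def using a b
    by (intro ideal_finsum[OF Q.is_ideal]) (auto simp: b_def Q.I_l_closed)
  have \<Psi>pc: "\<Psi> p \<in> carrier R" using \<Psi> p by simp
  define w where "w = \<delta> \<ominus> \<Psi> p"
  have w: "w \<in> carrier R" using \<delta>c \<Psi>pc by (simp add: w_def)
  have wQ: "w \<notin> Q"
  proof
    assume "w \<in> Q"
    then have "w \<oplus> \<Psi> p \<in> Q" using \<Psi>p by simp
    moreover have "w \<oplus> \<Psi> p = \<delta>" unfolding w_def using \<delta>c \<Psi>pc by algebra
    ultimately show False using \<delta> by simp
  qed
  have \<Psi>q: "\<Psi> (q j) = a j \<otimes> w" if j: "j < n" for j
  proof -
    have "\<Psi> (x j) = (\<Oplus>k\<in>{..<n}. if j = k then a k \<otimes> \<delta> else \<zero>)"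
      unfolding \<Psi>_def by (rule R.finsum_cong') (use \<phi>x a j \<delta>c in auto)
    also have "\<dots> = a j \<otimes> \<delta>" by (rule R.finsum_singleton) (use j a \<delta>c in auto)
    finally have "\<Psi> (q j) = a j \<otimes> \<delta> \<ominus> a j \<otimes> \<Psi> p" using form_q[OF \<Psi> j] by simp
    also have "\<dots> = a j \<otimes> w" unfolding w_def using a[OF j] \<delta>c \<Psi>pc by algebra
    finally show ?thesis .
  qed
  \<comment> \<open>the rows of the Sherman--Morrison inverse, cleared of denominators\<close>
  define \<phi>' where "\<phi>' i z = w \<otimes> \<phi> i z \<oplus> b i \<otimes> \<Psi> z" for i z
  have \<phi>': "\<phi>' i \<in> dual R M" if "i < n" for i
    unfolding \<phi>'_def
    by (rule dual_plus) (use \<phi>[OF that] \<Psi> w b(1)[OF that] in \<open>auto intro: dual_scale\<close>)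
  have \<phi>'q: "\<phi>' i (q j) = (if i = j then w \<otimes> \<delta> else \<zero>)" if i: "i < n" and j: "j < n" for i j
  proof -
    define e where "e = \<phi> i (x j)"
    have e: "e \<in> carrier R" using \<phi>[OF i] x[OF j] by (simp add: e_def)
    have "\<phi>' i (q j) = w \<otimes> (e \<ominus> a j \<otimes> b i) \<oplus> b i \<otimes> (a j \<otimes> w)"
      using form_q[OF \<phi>[OF i] j] \<Psi>q[OF j] by (simp add: \<phi>'_def b_def e_def)
    also have "\<dots> = w \<otimes> e" using w e a[OF j] b(1)[OF i] by algebra
    finally show ?thesis using \<phi>x[OF i j] w by (simp add: e_def)
  qed
  have "frame R M P1 n (w \<otimes> \<delta>)"
    unfolding frame_def using \<phi>' qP \<phi>'q by (intro exI[of _ \<phi>'] exI[of _ q]) auto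
  moreover have "w \<otimes> \<delta> \<in> carrier R - Q" using Q.I_prime[OF w \<delta>c] w wQ \<delta> by auto
  ultimately show ?thesis by auto
qed

definition local_frames ::
  "('a, 'k) ring_scheme \<Rightarrow> ('a, 'b, 'm) module_scheme \<Rightarrow> nat \<Rightarrow> bool" where
  "local_frames R M n \<longleftrightarrow> (\<forall>Q\<in>Spec R. \<exists>\<delta>\<in>carrier R - Q. frame R M (carrier M) n \<delta>)"

text \<open>
  Scaling the elements of a frame at \<open>Q\<close> by \<open>a \<notin> Q\<close> gives a frame at \<open>Q\<close> inside \<open>a M\<close>.
\<close>

lemma (in Module.module) unimodular_mod_scalar:
  assumes K: "kronecker_range R n" and fr: "local_frames R M n"
    and p: "p \<in> carrier M" and a: "a \<in> carrier R"
    and van: "\<And>Q. Q \<in> Spec R \<Longrightarrow> vanishes_at R M Q p \<Longrightarrow> a \<notin> Q"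
  shows "\<exists>q\<in>carrier M. unimodular R M (p \<oplus>\<^bsub>M\<^esub> a \<odot>\<^bsub>M\<^esub> q)"
proof -
  let ?N = "(\<lambda>x. a \<odot>\<^bsub>M\<^esub> x) ` carrier M"
  have "submodule ?N R M"
  proof (rule submoduleI)
    show "?N \<subseteq> carrier M" using a by auto
    show "\<zero>\<^bsub>M\<^esub> \<in> ?N" by (rule image_eqI[of _ _ "\<zero>\<^bsub>M\<^esub>"]) (use a in auto)
    show "\<ominus>\<^bsub>M\<^esub> x \<in> ?N" if "x \<in> ?N" for x
      using that a by (auto simp flip: smult_r_minus)
    show "x \<oplus>\<^bsub>M\<^esub> y \<in> ?N" if "x \<in> ?N" "y \<in> ?N" for x y
      using that a by (auto simp flip: smult_r_distr)
    show "c \<odot>\<^bsub>M\<^esub> x \<in> ?N" if c: "c \<in> carrier R" and "x \<in> ?N" for c x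
    proof -
      obtain y where y: "y \<in> carrier M" "x = a \<odot>\<^bsub>M\<^esub> y" using \<open>x \<in> ?N\<close> by auto
      have "c \<odot>\<^bsub>M\<^esub> x = a \<odot>\<^bsub>M\<^esub> (c \<odot>\<^bsub>M\<^esub> y)"
        using y c a by (simp add: m_comm flip: smult_assoc1)
      then show ?thesis using y c by simp
    qed
  qed
  moreover have "\<exists>\<delta>\<in>carrier R - Q. frame R M ?N n \<delta>"
    if Q: "Q \<in> Spec R" and v: "vanishes_at R M Q p" for Q
  proof -
    interpret Q: primeideal Q R using Q by (simp add: Spec_def)
    obtain \<delta> \<phi> x where \<delta>: "\<delta> \<in> carrier R" "\<delta> \<notin> Q" and \<phi>: "\<And>i. i < n \<Longrightarrow> \<phi> i \<in> dual R M"
      and x: "\<And>i. i < n \<Longrightarrow> x i \<in> carrier M"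
      and \<phi>x: "\<And>i j. i < n \<Longrightarrow> j < n \<Longrightarrow> \<phi> i (x j) = (if i = j then \<delta> else \<zero>)"
      using fr Q unfolding local_frames_def frame_def by (metis DiffE)
    have "frame R M ?N n (a \<otimes> \<delta>)"
      unfolding frame_def
      by (rule exI[of _ \<phi>], rule exI[of _ "\<lambda>j. a \<odot>\<^bsub>M\<^esub> x j"])
        (use \<phi> x \<phi>x a \<delta> in \<open>auto simp: dual_smult\<close>)
    moreover have "a \<otimes> \<delta> \<in> carrier R - Q" using Q.I_prime[OF a \<delta>(1)] van[OF Q v] \<delta> a by auto
    ultimately show ?thesis by auto
  qed
  ultimately obtain y where "y \<in> ?N" "unimodular R M (p \<oplus>\<^bsub>M\<^esub> y)"
    using unimodular_in_coset[OF K _ p] by metis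
  then show ?thesis by auto
qed

section \<open>Homomorphisms and direct sums\<close>

lemma (in abelian_group) minus_zero_imp_eq:
  assumes "x \<oplus> \<ominus> y = \<zero>" "x \<in> carrier G" "y \<in> carrier G"
  shows "x = y"
  using minus_equality[OF assms(1)] assms by simp

lemma module_hom_plus:
  assumes M: "Module.module R M" and N: "Module.module R N"
    and f: "f \<in> module_hom R M N" and g: "g \<in> module_hom R M N"
  shows "(\<lambda>z. f z \<oplus>\<^bsub>N\<^esub> g z) \<in> module_hom R M N"
proof -
  interpret M: Module.module R M by fact
  interpret N: Module.module R N by fact
  note c = module_hom_closed[OF f] module_hom_closed[OF g]
  show ?thesis
    by (rule module_homI)
      (use c in \<open>auto simp: module_hom_add[OF f] module_hom_add[OF g] module_hom_smult[OF f]
          module_hom_smult[OF g] N.smult_r_distr N.a_ac\<close>)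
qed

lemma module_hom_scale:
  assumes M: "Module.module R M" and N: "Module.module R N"
    and f: "f \<in> module_hom R M N" and a: "a \<in> carrier R"
  shows "(\<lambda>z. a \<odot>\<^bsub>N\<^esub> f z) \<in> module_hom R M N"
proof -
  interpret M: Module.module R M by fact
  interpret N: Module.module R N by fact
  note c = module_hom_closed[OF f]
  have "a \<odot>\<^bsub>N\<^esub> (b \<odot>\<^bsub>N\<^esub> f x) = b \<odot>\<^bsub>N\<^esub> (a \<odot>\<^bsub>N\<^esub> f x)" if "b \<in> carrier R" "x \<in> carrier M" for b x
    using that c a by (simp add: M.m_comm flip: N.smult_assoc1)
  then show ?thesis
    by (intro module_homI)
      (use c a in \<open>auto simp: module_hom_add[OF f] module_hom_smult[OF f] N.smult_r_distr\<close>)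
qed

lemma module_hom_times_element:
  assumes M: "Module.module R M" and N: "Module.module R N"
    and v: "v \<in> dual R M" and w: "w \<in> carrier N"
  shows "(\<lambda>z. v z \<odot>\<^bsub>N\<^esub> w) \<in> module_hom R M N"
proof -
  interpret M: Module.module R M by fact
  interpret N: Module.module R N by fact
  show ?thesis
    by (rule module_homI)
      (use v w in \<open>auto simp: M.dual_add M.dual_smult N.smult_l_distr N.smult_assoc1\<close>)
qed

lemma module_hom_comp:
  assumes "g \<in> module_hom R N L" "f \<in> module_hom R M N"
  shows "(\<lambda>z. g (f z)) \<in> module_hom R M L"
  using assms by (auto simp: module_hom_def Pi_iff)

lemma module_hom_ident: "(\<lambda>z. z) \<in> module_hom R M M"
  by (auto simp: module_hom_def)

lemma direct_sum_simps [simp]: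
  "carrier (direct_sum M N) = carrier M \<times> carrier N"
  "\<zero>\<^bsub>direct_sum M N\<^esub> = (\<zero>\<^bsub>M\<^esub>, \<zero>\<^bsub>N\<^esub>)"
  "(x, y) \<oplus>\<^bsub>direct_sum M N\<^esub> (x', y') = (x \<oplus>\<^bsub>M\<^esub> x', y \<oplus>\<^bsub>N\<^esub> y')"
  "a \<odot>\<^bsub>direct_sum M N\<^esub> (x, y) = (a \<odot>\<^bsub>M\<^esub> x, a \<odot>\<^bsub>N\<^esub> y)"
  by (simp_all add: direct_sum_def)

lemma direct_sum_module:
  assumes M: "Module.module R M" and N: "Module.module R N"
  shows "Module.module R (direct_sum M N)"
proof -
  interpret M: Module.module R M by fact
  interpret N: Module.module R N by fact
  show ?thesis
  proof (intro moduleI abelian_groupI M.is_cring)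
    fix z assume z: "z \<in> carrier (direct_sum M N)"
    show "\<exists>y\<in>carrier (direct_sum M N). y \<oplus>\<^bsub>direct_sum M N\<^esub> z = \<zero>\<^bsub>direct_sum M N\<^esub>"
      by (rule bexI[of _ "(\<ominus>\<^bsub>M\<^esub> fst z, \<ominus>\<^bsub>N\<^esub> snd z)"])
        (use z in \<open>auto simp: M.M.l_neg N.M.l_neg\<close>)
  qed (auto simp: M.M.a_ac N.M.a_ac M.smult_l_distr N.smult_l_distr M.smult_r_distr
      N.smult_r_distr M.smult_assoc1 N.smult_assoc1)
qed

lemma fst_module_hom: "fst \<in> module_hom R (direct_sum M N) M"
  and snd_module_hom: "snd \<in> module_hom R (direct_sum M N) N"
  by (auto simp: module_hom_def)

lemma module_hom_pair:
  assumes "f \<in> module_hom R L M" "g \<in> module_hom R L N"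
  shows "(\<lambda>z. (f z, g z)) \<in> module_hom R L (direct_sum M N)"
  using assms by (auto simp: module_hom_def Pi_iff)

lemma module_hom_inl:
  assumes M: "Module.module R M" and N: "Module.module R N"
  shows "(\<lambda>x. (x, \<zero>\<^bsub>N\<^esub>)) \<in> module_hom R M (direct_sum M N)"
proof -
  interpret M: Module.module R M by fact
  interpret N: Module.module R N by fact
  show ?thesis by (auto simp: module_hom_def)
qed

lemma module_hom_inj:
  assumes M: "Module.module R M" and N: "Module.module R N" and f: "f \<in> module_hom R M N"
    and ker: "\<And>x. x \<in> carrier M \<Longrightarrow> f x = \<zero>\<^bsub>N\<^esub> \<Longrightarrow> x = \<zero>\<^bsub>M\<^esub>"
  shows "inj_on f (carrier M)"
proof (rule inj_onI)
  interpret M: Module.module R M by fact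
  interpret N: Module.module R N by fact
  fix x y assume xy: "x \<in> carrier M" "y \<in> carrier M" "f x = f y"
  let ?m = "(\<ominus>\<^bsub>R\<^esub> \<one>\<^bsub>R\<^esub>) \<odot>\<^bsub>M\<^esub> y"
  have "f (x \<oplus>\<^bsub>M\<^esub> ?m) = f y \<oplus>\<^bsub>N\<^esub> (\<ominus>\<^bsub>R\<^esub> \<one>\<^bsub>R\<^esub>) \<odot>\<^bsub>N\<^esub> f y"
    using xy by (simp add: module_hom_add[OF f] module_hom_smult[OF f])
  also have "\<dots> = \<zero>\<^bsub>N\<^esub>"
    using module_hom_closed[OF f xy(2)] by (simp add: N.smult_l_minus N.M.r_neg)
  finally have "x \<oplus>\<^bsub>M\<^esub> ?m = \<zero>\<^bsub>M\<^esub>" using ker xy by simp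
  then have "x \<oplus>\<^bsub>M\<^esub> \<ominus>\<^bsub>M\<^esub> y = \<zero>\<^bsub>M\<^esub>" using xy by (simp add: M.smult_l_minus)
  then show "x = y" by (rule M.M.minus_zero_imp_eq) (use xy in auto)
qed

lemma module_isoI:
  assumes "f \<in> module_hom R M N" "g \<in> module_hom R N M"
    and "\<And>x. x \<in> carrier M \<Longrightarrow> g (f x) = x" "\<And>y. y \<in> carrier N \<Longrightarrow> f (g y) = y"
  shows "module_iso R M N"
  unfolding module_iso_def
  using assms by (intro bexI[of _ f] bij_betwI[of f _ _ g]) (auto simp: module_hom_def)

lemma module_isoE:
  assumes M: "Module.module R M" and iso: "module_iso R M N"
  obtains f g where "f \<in> module_hom R M N" "g \<in> module_hom R N M"
    "\<And>x. x \<in> carrier M \<Longrightarrow> g (f x) = x" "\<And>y. y \<in> carrier N \<Longrightarrow> f (g y) = y"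
proof -
  interpret M: Module.module R M by fact
  obtain f where f: "f \<in> module_hom R M N" and bij: "bij_betw f (carrier M) (carrier N)"
    using iso by (auto simp: module_iso_def)
  define g where "g = the_inv_into (carrier M) f"
  have inj: "inj_on f (carrier M)" and im: "f ` carrier M = carrier N"
    using bij by (auto simp: bij_betw_def)
  have gf: "g (f x) = x" if "x \<in> carrier M" for x
    unfolding g_def using inj that by (rule the_inv_into_f_f)
  have gc: "g y \<in> carrier M" and fg: "f (g y) = y" if "y \<in> carrier N" for y
  proof -
    obtain x where "x \<in> carrier M" "y = f x" using im \<open>y \<in> carrier N\<close> by auto
    then show "g y \<in> carrier M" "f (g y) = y" using gf by simp_all
  qed
  have "g \<in> module_hom R N M"
  proof (rule module_homI)
    show "g y \<in> carrier M" if "y \<in> carrier N" for y using gc that .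
    show "g (y \<oplus>\<^bsub>N\<^esub> z) = g y \<oplus>\<^bsub>M\<^esub> g z" if "y \<in> carrier N" "z \<in> carrier N" for y z
      using gf[of "g y \<oplus>\<^bsub>M\<^esub> g z"] that gc fg by (simp add: module_hom_add[OF f])
    show "g (a \<odot>\<^bsub>N\<^esub> y) = a \<odot>\<^bsub>M\<^esub> g y" if "a \<in> carrier R" "y \<in> carrier N" for a y
      using gf[of "a \<odot>\<^bsub>M\<^esub> g y"] that gc fg by (simp add: module_hom_smult[OF f])
  qed
  with f gf fg show thesis using that by simp
qed

lemma module_iso_sym:
  assumes "Module.module R M" "module_iso R M N"
  shows "module_iso R N M"
  using module_isoE[OF assms] module_isoI by metis

lemma module_iso_trans:
  assumes "module_iso R L M" "module_iso R M N"
  shows "module_iso R L N"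
proof -
  obtain f where f: "f \<in> module_hom R L M" "bij_betw f (carrier L) (carrier M)"
    using assms(1) by (auto simp: module_iso_def)
  obtain g where g: "g \<in> module_hom R M N" "bij_betw g (carrier M) (carrier N)"
    using assms(2) by (auto simp: module_iso_def)
  have "bij_betw (\<lambda>z. g (f z)) (carrier L) (carrier N)"
    using bij_betw_trans[OF f(2) g(2)] by (simp add: o_def)
  then show ?thesis using module_hom_comp[OF g(1) f(1)] by (auto simp: module_iso_def)
qed

section \<open>Cancelling one free summand\<close>

text \<open>
  Let \<open>(p, a)\<close> correspond to \<open>(0, 1)\<close>.  Some linear form on \<open>A \<oplus> R\<close> takes the value \<open>1\<close> at \<open>(p, a)\<close>, so
  \<open>a\<close> is a unit at every prime where \<open>p\<close> vanishes, and \<open>p' = p + a q\<close> is unimodular for some \<open>q\<close>; let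
  \<open>\<psi>(p') = 1\<close>.  The elementary automorphisms \<open>(x, c) \<mapsto> (x + c q, c)\<close>, \<open>(x, c) \<mapsto> (x, c + (1 - a) \<psi>(x))\<close>
  and \<open>(x, c) \<mapsto> (x - c p', c)\<close> carry \<open>(p, a)\<close> successively to \<open>(p', a)\<close>, \<open>(p', 1)\<close> and \<open>(0, 1)\<close>.
  Below, \<open>T\<close> is the first component of their composition: a surjection onto \<open>A\<close> with kernel
  \<open>R (p, a)\<close>.  Composed with the inclusion of \<open>B\<close> into \<open>B \<oplus> R \<cong> A \<oplus> R\<close> it is an isomorphism, as
  \<open>B\<close> is a complement of the line \<open>R (0, 1)\<close>.
\<close>

lemma cancel_regular_module:
  assumes A: "Module.module R A" and B: "Module.module R B"
    and K: "kronecker_range R n" and fr: "local_frames R A n"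
    and iso: "module_iso R (direct_sum A (regular_module R)) (direct_sum B (regular_module R))"
  shows "module_iso R A B"
proof -
  interpret A: Module.module R A by fact
  interpret B: Module.module R B by fact
  let ?AR = "direct_sum A (regular_module R)" and ?BR = "direct_sum B (regular_module R)"
  note AR = direct_sum_module[OF A A.regular_module_module]
  note BR = direct_sum_module[OF B A.regular_module_module]
  interpret AR: Module.module R ?AR by (rule AR)
  have regular [simp]: "carrier (regular_module R) = carrier R" "\<zero>\<^bsub>regular_module R\<^esub> = \<zero>\<^bsub>R\<^esub>"
    "add (regular_module R) = add R" "smult (regular_module R) = monoid.mult R"
    by (simp_all add: regular_module_def)
  obtain f g where f: "f \<in> module_hom R ?AR ?BR" and g: "g \<in> module_hom R ?BR ?AR"
    and gf: "\<And>x. x \<in> carrier ?AR \<Longrightarrow> g (f x) = x"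
    and fg: "\<And>y. y \<in> carrier ?BR \<Longrightarrow> f (g y) = y"
    using module_isoE[OF AR iso] by metis
  have e: "(\<zero>\<^bsub>B\<^esub>, \<one>\<^bsub>R\<^esub>) \<in> carrier ?BR" by simp
  obtain p a where pa: "g (\<zero>\<^bsub>B\<^esub>, \<one>\<^bsub>R\<^esub>) = (p, a)" by (cases "g (\<zero>\<^bsub>B\<^esub>, \<one>\<^bsub>R\<^esub>)")
  then have p: "p \<in> carrier A" and a: "a \<in> carrier R"
    using module_hom_closed[OF g e] by auto
  have coord: "(\<lambda>z. snd (f z)) \<in> dual R ?AR"
    using module_hom_comp[OF snd_module_hom f] .
  have "a \<notin> Q" if Q: "Q \<in> Spec R" and van: "vanishes_at R A Q p" for Q
  proof
    assume aQ: "a \<in> Q"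
    interpret Q: primeideal Q R using Q by (simp add: Spec_def)
    define l where "l = (\<lambda>z. snd (f z))"
    have l: "l \<in> dual R ?AR" unfolding l_def by (rule coord)
    have "(\<lambda>x. l (x, \<zero>\<^bsub>R\<^esub>)) \<in> dual R A"
      using module_hom_comp[OF l module_hom_inl[OF A A.regular_module_module]] by simp
    then have lp: "l (p, \<zero>\<^bsub>R\<^esub>) \<in> Q" using van by (auto simp: vanishes_at_def)
    have "(p, a) = (p, \<zero>\<^bsub>R\<^esub>) \<oplus>\<^bsub>?AR\<^esub> a \<odot>\<^bsub>?AR\<^esub> (\<zero>\<^bsub>A\<^esub>, \<one>\<^bsub>R\<^esub>)" using p a by simp
    then have "l (p, a) = l (p, \<zero>\<^bsub>R\<^esub>) \<oplus>\<^bsub>R\<^esub> a \<otimes>\<^bsub>R\<^esub> l (\<zero>\<^bsub>A\<^esub>, \<one>\<^bsub>R\<^esub>)"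
      using AR.dual_add[OF l, of "(p, \<zero>\<^bsub>R\<^esub>)" "a \<odot>\<^bsub>?AR\<^esub> (\<zero>\<^bsub>A\<^esub>, \<one>\<^bsub>R\<^esub>)"]
        AR.dual_smult[OF l a, of "(\<zero>\<^bsub>A\<^esub>, \<one>\<^bsub>R\<^esub>)"] p a by simp
    also have "\<dots> \<in> Q"
      using lp aQ AR.dual_closed[OF l, of "(\<zero>\<^bsub>A\<^esub>, \<one>\<^bsub>R\<^esub>)"] by (simp add: Q.I_r_closed)
    finally have "l (p, a) \<in> Q" .
    moreover have "l (p, a) = \<one>\<^bsub>R\<^esub>" unfolding l_def using fg[OF e] pa by simp
    ultimately show False using Q.one_notin by simp
  qed
  then obtain q where q: "q \<in> carrier A" and uni: "unimodular R A (p \<oplus>\<^bsub>A\<^esub> a \<odot>\<^bsub>A\<^esub> q)"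
    using A.unimodular_mod_scalar[OF K fr p a] by metis
  define p' where "p' = p \<oplus>\<^bsub>A\<^esub> a \<odot>\<^bsub>A\<^esub> q"
  have p': "p' \<in> carrier A" using p a q by (simp add: p'_def)
  obtain \<psi> where \<psi>: "\<psi> \<in> dual R A" and \<psi>p': "\<psi> p' = \<one>\<^bsub>R\<^esub>"
    using uni by (auto simp: unimodular_def p'_def)
  define u where "u z = fst z \<oplus>\<^bsub>A\<^esub> snd z \<odot>\<^bsub>A\<^esub> q" for z
  define v where "v z = snd z \<oplus>\<^bsub>R\<^esub> (\<one>\<^bsub>R\<^esub> \<ominus>\<^bsub>R\<^esub> a) \<otimes>\<^bsub>R\<^esub> \<psi> (u z)" for z
  define T where "T z = u z \<oplus>\<^bsub>A\<^esub> ((\<ominus>\<^bsub>R\<^esub> \<one>\<^bsub>R\<^esub>) \<otimes>\<^bsub>R\<^esub> v z) \<odot>\<^bsub>A\<^esub> p'" for z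
  have u: "u \<in> module_hom R ?AR A"
    unfolding u_def
    by (intro module_hom_plus[OF AR A] fst_module_hom module_hom_times_element[OF AR A] q
        snd_module_hom)
  have v: "v \<in> dual R ?AR"
    unfolding v_def
    by (intro AR.dual_plus AR.dual_scale snd_module_hom module_hom_comp[OF \<psi> u]) (use a in auto)
  have T: "T \<in> module_hom R ?AR A"
    unfolding T_def
    by (intro module_hom_plus[OF AR A] u module_hom_times_element[OF AR A] AR.dual_scale v p') simp
  \<comment> \<open>From \<open>T z = 0\<close> one gets \<open>u z = (v z) p'\<close>, hence \<open>\<psi> (u z) = v z\<close>; then solve for \<open>c\<close> and \<open>x\<close>.\<close>
  have T_kernel: "\<exists>c\<in>carrier R. z = c \<odot>\<^bsub>?AR\<^esub> (p, a)" if z: "z \<in> carrier ?AR" and Tz: "T z = \<zero>\<^bsub>A\<^esub>" for z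
  proof -
    obtain x c where xc: "z = (x, c)" "x \<in> carrier A" "c \<in> carrier R" using z by auto
    have uz: "u z \<in> carrier A" and vz: "v z \<in> carrier R"
      using module_hom_closed[OF u z] AR.dual_closed[OF v z] by auto
    have "u z \<oplus>\<^bsub>A\<^esub> \<ominus>\<^bsub>A\<^esub> (v z \<odot>\<^bsub>A\<^esub> p') = \<zero>\<^bsub>A\<^esub>"
      using Tz vz p' by (simp add: T_def A.smult_l_minus A.l_minus)
    then have uv: "u z = v z \<odot>\<^bsub>A\<^esub> p'"
      by (rule A.M.minus_zero_imp_eq) (use uz vz p' in auto)
    then have "\<psi> (u z) = v z" using A.dual_smult[OF \<psi> vz p'] \<psi>p' vz by simp
    then have "v z = c \<oplus>\<^bsub>R\<^esub> (\<one>\<^bsub>R\<^esub> \<ominus>\<^bsub>R\<^esub> a) \<otimes>\<^bsub>R\<^esub> v z" by (simp add: v_def xc(1))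
    moreover have "v z \<otimes>\<^bsub>R\<^esub> a = v z \<ominus>\<^bsub>R\<^esub> (\<one>\<^bsub>R\<^esub> \<ominus>\<^bsub>R\<^esub> a) \<otimes>\<^bsub>R\<^esub> v z"
      using a vz by algebra
    moreover have "c = (c \<oplus>\<^bsub>R\<^esub> (\<one>\<^bsub>R\<^esub> \<ominus>\<^bsub>R\<^esub> a) \<otimes>\<^bsub>R\<^esub> v z) \<ominus>\<^bsub>R\<^esub> (\<one>\<^bsub>R\<^esub> \<ominus>\<^bsub>R\<^esub> a) \<otimes>\<^bsub>R\<^esub> v z"
      using a vz xc(3) by algebra
    ultimately have c: "c = v z \<otimes>\<^bsub>R\<^esub> a" by simp
    have "x \<oplus>\<^bsub>A\<^esub> c \<odot>\<^bsub>A\<^esub> q = u z" by (simp add: u_def xc(1))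
    also have "\<dots> = v z \<odot>\<^bsub>A\<^esub> p \<oplus>\<^bsub>A\<^esub> c \<odot>\<^bsub>A\<^esub> q"
      unfolding uv c p'_def using p a q vz by (simp add: A.smult_r_distr A.smult_assoc1)
    finally have x: "x = v z \<odot>\<^bsub>A\<^esub> p" using p q vz xc(2,3) by simp
    have "v z \<odot>\<^bsub>?AR\<^esub> (p, a) = (x, c)" by (simp flip: x c)
    then have "z = v z \<odot>\<^bsub>?AR\<^esub> (p, a)" unfolding xc(1)[symmetric] by (rule sym)
    then show ?thesis by (rule bexI) (rule vz)
  qed
  have T_pa: "T (p, a) = \<zero>\<^bsub>A\<^esub>"
  proof -
    have "u (p, a) = p'" by (simp add: u_def p'_def)
    moreover have "v (p, a) = \<one>\<^bsub>R\<^esub>"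
    proof -
      have "a \<oplus>\<^bsub>R\<^esub> (\<one>\<^bsub>R\<^esub> \<ominus>\<^bsub>R\<^esub> a) \<otimes>\<^bsub>R\<^esub> \<one>\<^bsub>R\<^esub> = \<one>\<^bsub>R\<^esub>" using a by algebra
      then show ?thesis using \<open>u (p, a) = p'\<close> \<psi>p' by (simp add: v_def)
    qed
    ultimately show ?thesis using p' by (simp add: T_def A.smult_l_minus A.M.r_neg)
  qed
  have T_onto: "\<exists>z\<in>carrier ?AR. T z = x" if x: "x \<in> carrier A" for x
  proof -
    \<comment> \<open>the preimage of \<open>(x, 0)\<close> under the three automorphisms\<close>
    define c where "c = \<ominus>\<^bsub>R\<^esub> ((\<one>\<^bsub>R\<^esub> \<ominus>\<^bsub>R\<^esub> a) \<otimes>\<^bsub>R\<^esub> \<psi> x)"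
    have \<psi>x: "\<psi> x \<in> carrier R" using \<psi> x by simp
    have c: "c \<in> carrier R" using a \<psi>x by (simp add: c_def)
    define z where "z = (x \<ominus>\<^bsub>A\<^esub> c \<odot>\<^bsub>A\<^esub> q, c)"
    have z: "z \<in> carrier ?AR" using x c q by (simp add: z_def)
    have uz: "u z = x"
      using x c q by (simp add: u_def z_def A.M.minus_eq A.M.a_assoc A.M.l_neg)
    have "c \<oplus>\<^bsub>R\<^esub> (\<one>\<^bsub>R\<^esub> \<ominus>\<^bsub>R\<^esub> a) \<otimes>\<^bsub>R\<^esub> \<psi> x = \<zero>\<^bsub>R\<^esub>"
      unfolding c_def using a \<psi>x by (simp add: A.R.l_neg)
    then have "v z = \<zero>\<^bsub>R\<^esub>" using uz by (simp add: v_def) (simp add: z_def)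
    then have "T z = x" using uz x p' by (simp add: T_def)
    then show ?thesis using z by auto
  qed
  define h where "h y = T (g (y, \<zero>\<^bsub>R\<^esub>))" for y
  have h: "h \<in> module_hom R B A"
    using module_hom_comp[OF T module_hom_comp[OF g module_hom_inl[OF B A.regular_module_module]]]
    by (simp add: h_def[abs_def])
  have g_line: "g (\<zero>\<^bsub>B\<^esub>, c) = c \<odot>\<^bsub>?AR\<^esub> (p, a)" if "c \<in> carrier R" for c
    using module_hom_smult[OF g that e] that by (simp add: pa)
  have "inj_on h (carrier B)"
  proof (rule module_hom_inj[OF B A h])
    fix y assume y: "y \<in> carrier B" and hy: "h y = \<zero>\<^bsub>A\<^esub>"
    have yc: "(y, \<zero>\<^bsub>R\<^esub>) \<in> carrier ?BR" using y by simp
    have "\<exists>c\<in>carrier R. g (y, \<zero>\<^bsub>R\<^esub>) = c \<odot>\<^bsub>?AR\<^esub> (p, a)"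
      by (rule T_kernel[OF module_hom_closed[OF g yc]]) (use hy in \<open>simp add: h_def\<close>)
    then obtain c where c: "c \<in> carrier R" "g (y, \<zero>\<^bsub>R\<^esub>) = c \<odot>\<^bsub>?AR\<^esub> (p, a)"
      by (rule bexE)
    have eq: "g (y, \<zero>\<^bsub>R\<^esub>) = g (\<zero>\<^bsub>B\<^esub>, c)"
      unfolding c(2) g_line[OF c(1)] by (rule refl)
    have "(y, \<zero>\<^bsub>R\<^esub>) = f (g (y, \<zero>\<^bsub>R\<^esub>))" by (rule fg[OF yc, symmetric])
    also have "\<dots> = (\<zero>\<^bsub>B\<^esub>, c)" unfolding eq by (rule fg) (use c(1) in simp)
    finally show "y = \<zero>\<^bsub>B\<^esub>" by simp
  qed
  moreover have "h ` carrier B = carrier A"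
  proof
    show "h ` carrier B \<subseteq> carrier A" using module_hom_closed[OF h] by auto
    show "carrier A \<subseteq> h ` carrier B"
    proof
      fix x assume x: "x \<in> carrier A"
      obtain z where z: "z \<in> carrier ?AR" "T z = x" using T_onto[OF x] by (rule bexE)
      obtain y c where yc: "f z = (y, c)" "y \<in> carrier B" "c \<in> carrier R"
        using module_hom_closed[OF f z(1)] by (cases "f z") auto
      have yc1: "(y, \<zero>\<^bsub>R\<^esub>) \<in> carrier ?BR" and yc2: "(\<zero>\<^bsub>B\<^esub>, c) \<in> carrier ?BR" using yc by auto
      have "f z = (y, \<zero>\<^bsub>R\<^esub>) \<oplus>\<^bsub>?BR\<^esub> (\<zero>\<^bsub>B\<^esub>, c)" using yc by simp
      then have "z = g (y, \<zero>\<^bsub>R\<^esub>) \<oplus>\<^bsub>?AR\<^esub> c \<odot>\<^bsub>?AR\<^esub> (p, a)"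
        using gf[OF z(1)] module_hom_add[OF g yc1 yc2] g_line[OF yc(3)] by simp
      moreover have "(p, a) \<in> carrier ?AR" using p a by simp
      ultimately have "T z = h y \<oplus>\<^bsub>A\<^esub> c \<odot>\<^bsub>A\<^esub> T (p, a)"
        using module_hom_closed[OF g yc1] yc(3)
        by (simp only: h_def module_hom_add[OF T] module_hom_smult[OF T] AR.smult_closed)
      then have "x = h y" using z(2) T_pa yc module_hom_closed[OF h yc(2)] by simp
      then show "x \<in> h ` carrier B" using yc(2) by simp
    qed
  qed
  ultimately have "module_iso R B A" using h by (auto simp: module_iso_def bij_betw_def)
  then show ?thesis by (rule module_iso_sym[OF B])
qed

section \<open>Free modules and cancellation of projective summands\<close>

lemma free_module_simps [simp]:
  "carrier (free_module R X) =
    {f. f \<in> X \<rightarrow> carrier R \<and> (\<forall>x. x \<notin> X \<longrightarrow> f x = \<zero>\<^bsub>R\<^esub>) \<and> finite {x. f x \<noteq> \<zero>\<^bsub>R\<^esub>}}"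
  "\<zero>\<^bsub>free_module R X\<^esub> = (\<lambda>_. \<zero>\<^bsub>R\<^esub>)"
  "f \<oplus>\<^bsub>free_module R X\<^esub> g = (\<lambda>x. f x \<oplus>\<^bsub>R\<^esub> g x)"
  "a \<odot>\<^bsub>free_module R X\<^esub> f = (\<lambda>x. a \<otimes>\<^bsub>R\<^esub> f x)"
  by (simp_all add: free_module_def)

lemma (in cring) free_module_apply_closed:
  assumes "f \<in> carrier (free_module R X)"
  shows "f x \<in> carrier R"
  using assms by (cases "x \<in> X") auto

lemma (in cring) free_module_module: "Module.module R (free_module R X)"
proof -
  note c = free_module_apply_closed[where X = X, simplified]
  have supp_add: "finite {x. f x \<oplus> g x \<noteq> \<zero>}"
    if "finite {x. f x \<noteq> \<zero>}" "finite {x. g x \<noteq> \<zero>}" for f g :: "'c \<Rightarrow> 'a"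
    by (rule finite_subset[of _ "{x. f x \<noteq> \<zero>} \<union> {x. g x \<noteq> \<zero>}"]) (use that in auto)
  have supp_smult: "finite {x. a \<otimes> f x \<noteq> \<zero>}"
    if "finite {x. f x \<noteq> \<zero>}" "a \<in> carrier R" for f :: "'c \<Rightarrow> 'a" and a
    by (rule finite_subset[of _ "{x. f x \<noteq> \<zero>}"]) (use that in auto)
  show ?thesis
  proof (intro moduleI abelian_groupI is_cring)
    fix f assume f: "f \<in> carrier (free_module R X)"
    show "\<exists>g\<in>carrier (free_module R X). g \<oplus>\<^bsub>free_module R X\<^esub> f = \<zero>\<^bsub>free_module R X\<^esub>"
    proof (rule bexI[of _ "\<lambda>x. (\<ominus> \<one>) \<otimes> f x"])
      show "(\<lambda>x. (\<ominus> \<one>) \<otimes> f x) \<oplus>\<^bsub>free_module R X\<^esub> f = \<zero>\<^bsub>free_module R X\<^esub>"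
        using free_module_apply_closed[OF f] by (auto simp: fun_eq_iff l_minus l_neg)
      show "(\<lambda>x. (\<ominus> \<one>) \<otimes> f x) \<in> carrier (free_module R X)"
        using f supp_smult[of f "\<ominus> \<one>"] by (auto simp: Pi_iff)
    qed
  qed (auto simp: Pi_iff fun_eq_iff supp_add supp_smult a_ac m_assoc l_distr r_distr c)
qed

lemma (in cring) free_module_update:
  assumes "f \<in> carrier (free_module R X)" "c \<in> carrier R" "k \<in> Y" "X \<subseteq> Y"
  shows "f(k := c) \<in> carrier (free_module R Y)"
proof -
  have "finite {x. (f(k := c)) x \<noteq> \<zero>}"
    by (rule finite_subset[of _ "insert k {x. f x \<noteq> \<zero>}"]) (use assms in auto)
  moreover have "f x \<in> carrier R" for x using free_module_apply_closed[OF assms(1)] .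
  ultimately show ?thesis using assms by (auto simp: Pi_iff)
qed

lemma (in cring) free_module_erase:
  assumes "f \<in> carrier (free_module R (insert k X))"
  shows "f(k := \<zero>) \<in> carrier (free_module R X)"
proof -
  have "finite {x. (f(k := \<zero>)) x \<noteq> \<zero>}"
    by (rule finite_subset[of _ "{x. f x \<noteq> \<zero>}"]) (use assms in auto)
  moreover have "f x \<in> carrier R" for x using free_module_apply_closed[OF assms] .
  ultimately show ?thesis using assms by (auto simp: Pi_iff)
qed

lemma (in cring) free_module_evaluation: "(\<lambda>f. f k) \<in> dual R (free_module R X)"
proof -
  interpret F: Module.module R "free_module R X" by (rule free_module_module)
  show ?thesis by (rule F.dualI) (use free_module_apply_closed in auto)
qed

definition unit_vector :: "('a, 'k) ring_scheme \<Rightarrow> 'x \<Rightarrow> 'x \<Rightarrow> 'a" where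
  "unit_vector R k = (\<lambda>x. if x = k then \<one>\<^bsub>R\<^esub> else \<zero>\<^bsub>R\<^esub>)"

lemma (in cring) unit_vector_in_free_module:
  assumes "k \<in> X"
  shows "unit_vector R k \<in> carrier (free_module R X)"
  using assms by (auto simp: unit_vector_def)

lemma (in Module.module) module_hom_free_module:
  assumes \<pi>: "\<pi> \<in> module_hom R (free_module R X) M" and "finite Y" "Y \<subseteq> X"
    and "f \<in> carrier (free_module R X)" "\<And>x. x \<notin> Y \<Longrightarrow> f x = \<zero>"
  shows "\<pi> f = (\<Oplus>\<^bsub>M\<^esub>k\<in>Y. f k \<odot>\<^bsub>M\<^esub> \<pi> (unit_vector R k))"
  using assms(2-)
proof (induction Y arbitrary: f)
  case empty
  then have "f = \<zero>\<^bsub>free_module R X\<^esub>" by auto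
  then show ?case
    using module_hom_zero[OF R.free_module_module module_axioms \<pi>] by simp
next
  case (insert k Y)
  note f = insert.prems(2)
  have kX: "k \<in> X" "insert k X = X" using insert.prems by auto
  note fc = R.free_module_apply_closed[OF f]
  have e: "\<pi> (unit_vector R j) \<in> carrier M" if "j \<in> X" for j
    using module_hom_closed[OF \<pi> R.unit_vector_in_free_module[OF that]] .
  define f' where "f' = f(k := \<zero>)"
  have f': "f' \<in> carrier (free_module R X)"
    unfolding f'_def using R.free_module_update[OF f R.zero_closed kX(1) subset_refl] .
  have ek: "f k \<odot>\<^bsub>free_module R X\<^esub> unit_vector R k \<in> carrier (free_module R X)"
    using Module.module.smult_closed[OF R.free_module_module fc R.unit_vector_in_free_module[OF kX(1)]] .
  have "f = f' \<oplus>\<^bsub>free_module R X\<^esub> f k \<odot>\<^bsub>free_module R X\<^esub> unit_vector R k"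
    using fc by (auto simp: f'_def unit_vector_def fun_eq_iff)
  then have "\<pi> f = \<pi> f' \<oplus>\<^bsub>M\<^esub> f k \<odot>\<^bsub>M\<^esub> \<pi> (unit_vector R k)"
    using module_hom_add[OF \<pi> f' ek]
      module_hom_smult[OF \<pi> fc R.unit_vector_in_free_module[OF kX(1)]] by metis
  also have "\<pi> f' = (\<Oplus>\<^bsub>M\<^esub>j\<in>Y. f' j \<odot>\<^bsub>M\<^esub> \<pi> (unit_vector R j))"
    by (rule insert.IH) (use insert.prems f' in \<open>auto simp: f'_def\<close>)
  also have "\<dots> = (\<Oplus>\<^bsub>M\<^esub>j\<in>Y. f j \<odot>\<^bsub>M\<^esub> \<pi> (unit_vector R j))"
    by (rule M.finsum_cong') (use insert e fc in \<open>auto simp: f'_def\<close>)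
  finally show ?case
    using insert.hyps insert.prems(1) e fc kX(1)
    by (subst M.finsum_insert) (auto intro!: M.a_comm M.finsum_closed simp: subset_iff)
qed

text \<open>
  A finite dual basis presents \<open>M\<close> as a direct summand of \<open>R\<^sup>Y\<close>; the \<open>\<psi>\<^sub>k\<close> are the coordinates of the
  inclusion and the \<open>h\<^sub>k\<close> the images of the unit vectors under the retraction.
\<close>

definition dual_basis ::
  "('a, 'k) ring_scheme \<Rightarrow> ('a, 'b, 'm) module_scheme \<Rightarrow> 'x set \<Rightarrow> ('x \<Rightarrow> 'b) \<Rightarrow> ('x \<Rightarrow> 'b \<Rightarrow> 'a) \<Rightarrow> bool"
  where
  "dual_basis R M Y h \<psi> \<longleftrightarrow> finite Y \<and> (\<forall>k\<in>Y. h k \<in> carrier M \<and> \<psi> k \<in> dual R M) \<and>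
     (\<forall>y\<in>carrier M. y = finsum M (\<lambda>k. \<psi> k y \<odot>\<^bsub>M\<^esub> h k) Y)"

text \<open>
  A finitely generated direct summand of a possibly infinite free module lives on finitely many
  coordinates: those in the supports of the generators.
\<close>

lemma fg_projective_dual_basis:
  fixes M :: "('a, 'b, 'm) module_scheme"
  assumes "fg_projective R M"
  shows "\<exists>(Y :: 'b set) h \<psi>. dual_basis R M Y h \<psi>"
proof -
  have M: "Module.module R M" using assms by (simp add: fg_projective_def projective_def)
  interpret M: Module.module R M by fact
  obtain X :: "'b set" and N :: "('a, 'b \<Rightarrow> 'a) module" where N: "Module.module R N"
    and iso: "module_iso R (direct_sum M N) (free_module R X)"
    using assms by (auto simp: fg_projective_def projective_def)
  interpret N: Module.module R N by fact
  let ?F = "free_module R X"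
  obtain f g where f: "f \<in> module_hom R (direct_sum M N) ?F"
    and g: "g \<in> module_hom R ?F (direct_sum M N)"
    and gf: "\<And>x. x \<in> carrier (direct_sum M N) \<Longrightarrow> g (f x) = x"
    using module_isoE[OF direct_sum_module[OF M N] iso] by metis
  obtain S where S: "finite S" "S \<subseteq> carrier M"
    and gen: "\<And>H. submodule H R M \<Longrightarrow> S \<subseteq> H \<Longrightarrow> H = carrier M"
    using assms by (auto simp: fg_projective_def finitely_generated_def)
  define \<gamma> where "\<gamma> y = f (y, \<zero>\<^bsub>N\<^esub>)" for y
  have \<gamma>: "\<gamma> \<in> module_hom R M ?F"
    unfolding \<gamma>_def by (rule module_hom_comp[OF f module_hom_inl[OF M N]])
  note \<gamma>c = module_hom_closed[OF \<gamma>]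
  define \<pi> where "\<pi> v = fst (g v)" for v
  have \<pi>: "\<pi> \<in> module_hom R ?F M"
    unfolding \<pi>_def by (rule module_hom_comp[OF fst_module_hom g])
  have \<pi>\<gamma>: "\<pi> (\<gamma> y) = y" if "y \<in> carrier M" for y
    using gf[of "(y, \<zero>\<^bsub>N\<^esub>)"] that by (simp add: \<pi>_def \<gamma>_def)
  define Y where "Y = (\<Union>s\<in>S. {x. \<gamma> s x \<noteq> \<zero>\<^bsub>R\<^esub>})"
  have Y: "finite Y" using S \<gamma>c by (auto simp: Y_def)
  have YX: "Y \<subseteq> X" using S(2) \<gamma>c by (auto simp: Y_def)
  define H where "H = {y \<in> carrier M. \<forall>x. x \<notin> Y \<longrightarrow> \<gamma> y x = \<zero>\<^bsub>R\<^esub>}"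
  have "submodule H R M"
  proof (rule M.submoduleI)
    show "H \<subseteq> carrier M" by (auto simp: H_def)
    show "\<zero>\<^bsub>M\<^esub> \<in> H"
      using module_hom_zero[OF M M.free_module_module \<gamma>] by (simp add: H_def)
    show sm: "a \<odot>\<^bsub>M\<^esub> y \<in> H" if "a \<in> carrier R" "y \<in> H" for a y
      using that by (auto simp: H_def module_hom_smult[OF \<gamma>])
    show "y \<oplus>\<^bsub>M\<^esub> z \<in> H" if "y \<in> H" "z \<in> H" for y z
      using that by (auto simp: H_def module_hom_add[OF \<gamma>])
    show "\<ominus>\<^bsub>M\<^esub> y \<in> H" if "y \<in> H" for y
      using sm[OF _ that, of "\<ominus>\<^bsub>R\<^esub> \<one>\<^bsub>R\<^esub>"] that by (simp add: M.smult_l_minus H_def)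
  qed
  moreover have "S \<subseteq> H" using S(2) by (auto simp: H_def Y_def)
  ultimately have "H = carrier M" by (rule gen)
  then have supp: "\<gamma> y x = \<zero>\<^bsub>R\<^esub>" if "y \<in> carrier M" "x \<notin> Y" for x y
    using that unfolding H_def by auto
  define h where "h k = \<pi> (unit_vector R k)" for k
  have "dual_basis R M Y h (\<lambda>k y. \<gamma> y k)"
    unfolding dual_basis_def
  proof (intro conjI ballI Y)
    fix k assume k: "k \<in> Y"
    show "h k \<in> carrier M"
      unfolding h_def using k YX
      by (intro module_hom_closed[OF \<pi>] M.unit_vector_in_free_module) auto
    show "(\<lambda>y. \<gamma> y k) \<in> dual R M"
      by (rule module_hom_comp[OF M.free_module_evaluation \<gamma>])
  next
    fix y assume y: "y \<in> carrier M"
    show "y = finsum M (\<lambda>k. \<gamma> y k \<odot>\<^bsub>M\<^esub> h k) Y"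
      unfolding h_def
      by (subst \<pi>\<gamma>[OF y, symmetric], rule M.module_hom_free_module[OF \<pi> Y YX \<gamma>c[OF y]])
        (rule supp[OF y])
  qed
  then show ?thesis by auto
qed

lemma local_frames_direct_sum:
  assumes A: "Module.module R A" and N: "Module.module R N" and fr: "local_frames R A n"
  shows "local_frames R (direct_sum A N) n"
  unfolding local_frames_def
proof
  interpret A: Module.module R A by fact
  interpret N: Module.module R N by fact
  fix Q assume "Q \<in> Spec R"
  then obtain \<delta> \<phi> x where \<delta>: "\<delta> \<in> carrier R - Q" and \<phi>: "\<And>i. i < n \<Longrightarrow> \<phi> i \<in> dual R A"
    and x: "\<And>i. i < n \<Longrightarrow> x i \<in> carrier A"
    and \<phi>x: "\<And>i j. i < n \<Longrightarrow> j < n \<Longrightarrow> \<phi> i (x j) = (if i = j then \<delta> else \<zero>\<^bsub>R\<^esub>)"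
    using fr unfolding local_frames_def frame_def by metis
  have "frame R (direct_sum A N) (carrier (direct_sum A N)) n \<delta>"
    unfolding frame_def
    by (rule exI[of _ "\<lambda>i z. \<phi> i (fst z)"], rule exI[of _ "\<lambda>j. (x j, \<zero>\<^bsub>N\<^esub>)"])
      (use \<phi> x \<phi>x in \<open>auto intro: module_hom_comp fst_module_hom\<close>)
  with \<delta> show "\<exists>\<delta>\<in>carrier R - Q. frame R (direct_sum A N) (carrier (direct_sum A N)) n \<delta>"
    by auto
qed

lemma direct_sum_free_module_empty_iso:
  assumes A: "Module.module R A"
  shows "module_iso R (direct_sum A (free_module R {})) A"
proof -
  interpret A: Module.module R A by fact
  show ?thesis
    by (rule module_isoI[OF fst_module_hom module_hom_inl[OF A A.free_module_module]]) auto
qed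

lemma direct_sum_free_module_insert_iso:
  assumes A: "Module.module R A" and k: "k \<notin> X"
  shows "module_iso R (direct_sum A (free_module R (insert k X)))
    (direct_sum (direct_sum A (free_module R X)) (regular_module R))"
proof -
  interpret A: Module.module R A by fact
  let ?F = "free_module R (insert k X)"
  have erase: "(\<lambda>v. v(k := \<zero>\<^bsub>R\<^esub>)) \<in> module_hom R ?F (free_module R X)"
    by (rule module_homI) (use A.free_module_erase in \<open>auto simp: fun_eq_iff simp del: free_module_simps(1)\<close>)
  show ?thesis
  proof (rule module_isoI)
    show "(\<lambda>z. ((fst z, (snd z)(k := \<zero>\<^bsub>R\<^esub>)), snd z k)) \<in> module_hom R (direct_sum A ?F)
        (direct_sum (direct_sum A (free_module R X)) (regular_module R))"
      by (intro module_hom_pair fst_module_hom module_hom_comp[OF erase snd_module_hom]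
          module_hom_comp[OF A.free_module_evaluation snd_module_hom])
    show "(\<lambda>z. (fst (fst z), (snd (fst z))(k := snd z))) \<in> module_hom R
        (direct_sum (direct_sum A (free_module R X)) (regular_module R)) (direct_sum A ?F)"
      by (rule module_homI)
        (use A.free_module_update[OF _ _ insertI1 subset_insertI] in
          \<open>auto simp: fun_eq_iff regular_module_def simp del: free_module_simps(1)\<close>)
    fix z assume "z \<in> carrier (direct_sum (direct_sum A (free_module R X)) (regular_module R))"
    then show "(\<lambda>z. ((fst z, (snd z)(k := \<zero>\<^bsub>R\<^esub>)), snd z k))
        ((\<lambda>z. (fst (fst z), (snd (fst z))(k := snd z))) z) = z"
      using k by (auto simp: fun_eq_iff)
  qed auto
qed

lemma cancel_free_module:
  assumes A: "Module.module R A" and B: "Module.module R B"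
    and K: "kronecker_range R n" and fr: "local_frames R A n" and "finite X"
    and "module_iso R (direct_sum A (free_module R X)) (direct_sum B (free_module R X))"
  shows "module_iso R A B"
  using assms(5,6)
proof (induction X)
  interpret A: Module.module R A by fact
  case empty
  have "module_iso R A (direct_sum A (free_module R {}))"
    using module_iso_sym[OF direct_sum_module[OF A A.free_module_module]]
      direct_sum_free_module_empty_iso[OF A] by metis
  from module_iso_trans[OF module_iso_trans[OF this empty] direct_sum_free_module_empty_iso[OF B]]
  show ?case .
next
  interpret A: Module.module R A by fact
  case (insert k X)
  note F = A.free_module_module
  have "module_iso R (direct_sum (direct_sum A (free_module R X)) (regular_module R))
      (direct_sum A (free_module R (insert k X)))"
    using module_iso_sym[OF direct_sum_module[OF A F]]
      direct_sum_free_module_insert_iso[OF A insert.hyps(2)] by metis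
  from module_iso_trans[OF module_iso_trans[OF this insert.prems]
      direct_sum_free_module_insert_iso[OF B insert.hyps(2)]]
  have "module_iso R (direct_sum A (free_module R X)) (direct_sum B (free_module R X))"
    by (rule cancel_regular_module[OF direct_sum_module[OF A F] direct_sum_module[OF B F] K
          local_frames_direct_sum[OF A F fr]])
  then show ?case by (rule insert.IH)
qed

text \<open>
  If \<open>C\<close> is a retract of \<open>F\<close> via \<open>\<iota>\<close> and \<open>\<pi>\<close>, then \<open>F\<close> is the sum of \<open>\<iota>(C)\<close> and the kernel of \<open>\<pi>\<close>.
  Transport \<open>f : A \<oplus> C \<rightarrow> B \<oplus> C\<close> along \<open>\<iota>\<close> and let it act as the identity on the kernel, in which
  \<open>v\<close> has the component \<open>v - \<iota> (\<pi> v)\<close>.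
\<close>

definition retract_extend where
  "retract_extend F \<iota> \<pi> f z = (fst (f (fst z, \<pi> (snd z))),
     \<iota> (snd (f (fst z, \<pi> (snd z)))) \<oplus>\<^bsub>F\<^esub> (snd z \<oplus>\<^bsub>F\<^esub> \<ominus>\<^bsub>F\<^esub> \<iota> (\<pi> (snd z))))"

lemma retract_extend_hom:
  assumes A: "Module.module R A" and B: "Module.module R B"
    and C: "Module.module R C" and F: "Module.module R F"
    and \<iota>: "\<iota> \<in> module_hom R C F" and \<pi>: "\<pi> \<in> module_hom R F C"
    and f: "f \<in> module_hom R (direct_sum A C) (direct_sum B C)"
  shows "retract_extend F \<iota> \<pi> f \<in> module_hom R (direct_sum A F) (direct_sum B F)"
proof -
  interpret F: Module.module R F by fact
  note AF = direct_sum_module[OF A F]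
  have mid: "(\<lambda>z. f (fst z, \<pi> (snd z))) \<in> module_hom R (direct_sum A F) (direct_sum B C)"
    by (intro module_hom_comp[OF f] module_hom_pair fst_module_hom module_hom_comp[OF \<pi> snd_module_hom])
  have "(\<lambda>v. (\<ominus>\<^bsub>R\<^esub> \<one>\<^bsub>R\<^esub>) \<odot>\<^bsub>F\<^esub> \<iota> (\<pi> v)) \<in> module_hom R F F"
    by (intro module_hom_scale[OF F F] module_hom_comp[OF \<iota> \<pi>]) simp
  then have "(\<lambda>v. v \<oplus>\<^bsub>F\<^esub> (\<ominus>\<^bsub>R\<^esub> \<one>\<^bsub>R\<^esub>) \<odot>\<^bsub>F\<^esub> \<iota> (\<pi> v)) \<in> module_hom R F F"
    by (intro module_hom_plus[OF F F] module_hom_ident)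
  moreover have "(\<ominus>\<^bsub>R\<^esub> \<one>\<^bsub>R\<^esub>) \<odot>\<^bsub>F\<^esub> \<iota> (\<pi> v) = \<ominus>\<^bsub>F\<^esub> \<iota> (\<pi> v)" if "v \<in> carrier F" for v
    using module_hom_closed[OF \<iota> module_hom_closed[OF \<pi> that]] by (simp add: F.smult_l_minus)
  ultimately have "(\<lambda>v. v \<oplus>\<^bsub>F\<^esub> \<ominus>\<^bsub>F\<^esub> \<iota> (\<pi> v)) \<in> module_hom R F F"
    by (simp add: module_hom_def Pi_iff)
  then have rest: "(\<lambda>z. snd z \<oplus>\<^bsub>F\<^esub> \<ominus>\<^bsub>F\<^esub> \<iota> (\<pi> (snd z))) \<in> module_hom R (direct_sum A F) F"
    by (rule module_hom_comp[OF _ snd_module_hom])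
  have main: "(\<lambda>z. \<iota> (snd (f (fst z, \<pi> (snd z))))) \<in> module_hom R (direct_sum A F) F"
    by (rule module_hom_comp[OF \<iota> module_hom_comp[OF snd_module_hom mid]])
  show ?thesis
    unfolding retract_extend_def[abs_def]
    by (rule module_hom_pair[OF module_hom_comp[OF fst_module_hom mid]
          module_hom_plus[OF AF F main rest]])
qed

lemma (in abelian_group) shuffle_cancel:
  assumes "a \<in> carrier G" "b \<in> carrier G" "v \<in> carrier G"
  shows "b \<oplus> ((a \<oplus> (v \<oplus> \<ominus> b)) \<oplus> \<ominus> a) = v"
proof -
  have "b \<oplus> ((a \<oplus> (v \<oplus> \<ominus> b)) \<oplus> \<ominus> a) = (b \<oplus> \<ominus> b) \<oplus> ((a \<oplus> \<ominus> a) \<oplus> v)"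
    using assms by (simp add: a_ac)
  then show ?thesis using assms by (simp add: r_neg)
qed

lemma retract_extend_inverse:
  assumes C: "Module.module R C" and F: "Module.module R F"
    and \<iota>: "\<iota> \<in> module_hom R C F" and \<pi>: "\<pi> \<in> module_hom R F C"
    and \<pi>\<iota>: "\<And>y. y \<in> carrier C \<Longrightarrow> \<pi> (\<iota> y) = y"
    and f: "f \<in> module_hom R (direct_sum A C) (direct_sum B C)"
    and gf: "\<And>w. w \<in> carrier (direct_sum A C) \<Longrightarrow> g (f w) = w"
    and z: "z \<in> carrier (direct_sum A F)"
  shows "retract_extend F \<iota> \<pi> g (retract_extend F \<iota> \<pi> f z) = z"
proof -
  interpret C: Module.module R C by fact
  interpret F: Module.module R F by fact
  obtain x v where xv: "z = (x, v)" "x \<in> carrier A" "v \<in> carrier F" using z by auto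
  have \<pi>v: "\<pi> v \<in> carrier C" using module_hom_closed[OF \<pi> xv(3)] .
  then have in_AC: "(x, \<pi> v) \<in> carrier (direct_sum A C)" using xv by simp
  obtain x' y' where w: "f (x, \<pi> v) = (x', y')" by (cases "f (x, \<pi> v)")
  then have y': "y' \<in> carrier C" using module_hom_closed[OF f in_AC] by simp
  have g: "g (x', y') = (x, \<pi> v)" using gf[OF in_AC] w by simp
  define v1 where "v1 = \<iota> y' \<oplus>\<^bsub>F\<^esub> (v \<oplus>\<^bsub>F\<^esub> \<ominus>\<^bsub>F\<^esub> \<iota> (\<pi> v))"
  note \<iota>c = module_hom_closed[OF \<iota>]
  have minus: "\<pi> (\<ominus>\<^bsub>F\<^esub> u) = \<ominus>\<^bsub>C\<^esub> \<pi> u" if "u \<in> carrier F" for u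
    using module_hom_smult[OF \<pi>, of "\<ominus>\<^bsub>R\<^esub> \<one>\<^bsub>R\<^esub>" u] that module_hom_closed[OF \<pi> that]
    by (simp add: F.smult_l_minus C.smult_l_minus)
  have "\<pi> v1 = y'"
    unfolding v1_def using y' \<pi>v xv(3) \<iota>c
    by (simp add: module_hom_add[OF \<pi>] minus \<pi>\<iota> C.M.r_neg)
  moreover have "retract_extend F \<iota> \<pi> f z = (x', v1)"
    by (simp add: retract_extend_def xv(1) w v1_def)
  ultimately have "retract_extend F \<iota> \<pi> g (retract_extend F \<iota> \<pi> f z) =
      (x, \<iota> (\<pi> v) \<oplus>\<^bsub>F\<^esub> (v1 \<oplus>\<^bsub>F\<^esub> \<ominus>\<^bsub>F\<^esub> \<iota> y'))"
    by (simp add: retract_extend_def g)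
  also have "\<dots> = z"
    unfolding v1_def xv(1) using F.M.shuffle_cancel[OF \<iota>c[OF y'] \<iota>c[OF \<pi>v] xv(3)] by simp
  finally show ?thesis .
qed

text \<open>
  Adding a complement of \<open>C\<close> in a free module to both sides turns the summand \<open>C\<close> into a free one.
\<close>

lemma free_complement_iso:
  assumes A: "Module.module R A" and B: "Module.module R B" and C: "Module.module R C"
    and basis: "dual_basis R C Y h \<psi>"
    and iso: "module_iso R (direct_sum A C) (direct_sum B C)"
  shows "module_iso R (direct_sum A (free_module R Y)) (direct_sum B (free_module R Y))"
proof -
  interpret A: Module.module R A by fact
  interpret C: Module.module R C by fact
  let ?F = "free_module R Y"
  note F = A.free_module_module[of Y]
  interpret F: Module.module R ?F by (rule F)
  have Y: "finite Y" and h: "\<And>k. k \<in> Y \<Longrightarrow> h k \<in> carrier C" and \<psi>: "\<And>k. k \<in> Y \<Longrightarrow> \<psi> k \<in> dual R C"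
    and expand: "\<And>y. y \<in> carrier C \<Longrightarrow> y = finsum C (\<lambda>k. \<psi> k y \<odot>\<^bsub>C\<^esub> h k) Y"
    using basis by (auto simp: dual_basis_def)
  define \<iota> where "\<iota> y = (\<lambda>k. if k \<in> Y then \<psi> k y else \<zero>\<^bsub>R\<^esub>)" for y
  have \<iota>: "\<iota> \<in> module_hom R C ?F"
  proof (rule module_homI)
    show "\<iota> y \<in> carrier ?F" if "y \<in> carrier C" for y
    proof -
      have "finite {k. \<iota> y k \<noteq> \<zero>\<^bsub>R\<^esub>}"
        by (rule finite_subset[OF _ Y]) (auto simp: \<iota>_def)
      then show ?thesis using \<psi> that by (auto simp: \<iota>_def)
    qed
  qed (use \<psi> in \<open>auto simp: \<iota>_def fun_eq_iff C.dual_add C.dual_smult\<close>)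
  define \<pi> where "\<pi> v = finsum C (\<lambda>k. v k \<odot>\<^bsub>C\<^esub> h k) Y" for v
  have vh: "(\<lambda>k. v k \<odot>\<^bsub>C\<^esub> h k) \<in> Y \<rightarrow> carrier C" if "v \<in> carrier ?F" for v
    using A.free_module_apply_closed[OF that] h by auto
  have \<pi>: "\<pi> \<in> module_hom R ?F C"
  proof (rule module_homI)
    show "\<pi> v \<in> carrier C" if "v \<in> carrier ?F" for v
      unfolding \<pi>_def using vh[OF that] by (rule C.M.finsum_closed)
    show "\<pi> (v \<oplus>\<^bsub>?F\<^esub> w) = \<pi> v \<oplus>\<^bsub>C\<^esub> \<pi> w" if v: "v \<in> carrier ?F" and w: "w \<in> carrier ?F" for v w
    proof -
      have "\<pi> (v \<oplus>\<^bsub>?F\<^esub> w) = finsum C (\<lambda>k. v k \<odot>\<^bsub>C\<^esub> h k \<oplus>\<^bsub>C\<^esub> w k \<odot>\<^bsub>C\<^esub> h k) Y"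
        unfolding \<pi>_def
        by (rule C.M.finsum_cong')
          (use h A.free_module_apply_closed[OF v] A.free_module_apply_closed[OF w] in
            \<open>auto simp: C.smult_l_distr\<close>)
      then show ?thesis unfolding \<pi>_def using C.M.finsum_addf[OF vh[OF v] vh[OF w]] by simp
    qed
    show "\<pi> (a \<odot>\<^bsub>?F\<^esub> v) = a \<odot>\<^bsub>C\<^esub> \<pi> v" if a: "a \<in> carrier R" and v: "v \<in> carrier ?F" for a v
    proof -
      have "\<pi> (a \<odot>\<^bsub>?F\<^esub> v) = finsum C (\<lambda>k. a \<odot>\<^bsub>C\<^esub> (v k \<odot>\<^bsub>C\<^esub> h k)) Y"
        unfolding \<pi>_def
        by (rule C.M.finsum_cong')
          (use h a A.free_module_apply_closed[OF v] in \<open>auto simp: C.smult_assoc1\<close>)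
      then show ?thesis
        unfolding \<pi>_def using C.finsum_smult_ldistr[OF Y a vh[OF v]] by simp
    qed
  qed
  have \<pi>\<iota>: "\<pi> (\<iota> y) = y" if "y \<in> carrier C" for y
  proof -
    have "\<pi> (\<iota> y) = finsum C (\<lambda>k. \<psi> k y \<odot>\<^bsub>C\<^esub> h k) Y"
      unfolding \<pi>_def by (rule C.M.finsum_cong') (use h \<psi> that in \<open>auto simp: \<iota>_def\<close>)
    then show ?thesis using expand[OF that] by simp
  qed
  note AC = direct_sum_module[OF A C]
  obtain f g where f: "f \<in> module_hom R (direct_sum A C) (direct_sum B C)"
    and g: "g \<in> module_hom R (direct_sum B C) (direct_sum A C)"
    and gf: "\<And>w. w \<in> carrier (direct_sum A C) \<Longrightarrow> g (f w) = w"
    and fg: "\<And>w. w \<in> carrier (direct_sum B C) \<Longrightarrow> f (g w) = w"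
    using module_isoE[OF AC iso] by metis
  show ?thesis
  proof (rule module_isoI[OF retract_extend_hom[OF A B C F \<iota> \<pi> f] retract_extend_hom[OF B A C F \<iota> \<pi> g]])
    show "retract_extend ?F \<iota> \<pi> g (retract_extend ?F \<iota> \<pi> f z) = z"
      if "z \<in> carrier (direct_sum A ?F)" for z
      by (rule retract_extend_inverse[OF C F \<iota> \<pi> _ f _ that]) (fact \<pi>\<iota> gf)+
    show "retract_extend ?F \<iota> \<pi> f (retract_extend ?F \<iota> \<pi> g z) = z"
      if "z \<in> carrier (direct_sum B ?F)" for z
      by (rule retract_extend_inverse[OF C F \<iota> \<pi> _ g _ that]) (fact \<pi>\<iota> fg)+
  qed
qed

section \<open>Local frames from constant rank\<close>

text \<open>
  The localized ring is obtained from the case in which \<open>M\<close> is the regular module, so what is proved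
  for fractions of \<open>M\<close> also serves for fractions of \<open>R\<close>.
\<close>

locale module_localization = Module.module R M for R (structure) and M (structure) +
  fixes S
  assumes S_carrier: "S \<subseteq> carrier R" and S_one: "\<one> \<in> S"
    and S_mult: "\<And>s t. s \<in> S \<Longrightarrow> t \<in> S \<Longrightarrow> s \<otimes> t \<in> S"
begin

lemma S_closed [simp]: "s \<in> S \<Longrightarrow> s \<in> carrier R"
  using S_carrier by auto

text \<open>
  One scalar on each side, instead of an iterated action, leaves all rearrangements to the
  commutativity of \<open>R\<close>.
\<close>

lemma fraction_rel_iff:
  "((x, s), (y, t)) \<in> fraction_rel R S M \<longleftrightarrow>
    x \<in> carrier M \<and> s \<in> S \<and> y \<in> carrier M \<and> t \<in> S \<and>
    (\<exists>u\<in>S. (u \<otimes> t) \<odot>\<^bsub>M\<^esub> x = (u \<otimes> s) \<odot>\<^bsub>M\<^esub> y)"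
  by (auto simp: fraction_rel_def smult_assoc1)

lemma equiv_fraction_rel: "equiv (carrier M \<times> S) (fraction_rel R S M)"
proof (rule equivI)
  show "fraction_rel R S M \<subseteq> (carrier M \<times> S) \<times> (carrier M \<times> S)"
    by (auto simp: fraction_rel_def)
  show "refl_on (carrier M \<times> S) (fraction_rel R S M)"
    using S_one by (auto simp: refl_on_def fraction_rel_iff)
  show "sym (fraction_rel R S M)"
    by (rule symI) (auto simp: fraction_rel_iff, metis)
  show "trans (fraction_rel R S M)"
  proof (rule transI)
    fix X Y Z assume XY: "(X, Y) \<in> fraction_rel R S M" and YZ: "(Y, Z) \<in> fraction_rel R S M"
    obtain x s y t z r where X: "X = (x, s)" and Y: "Y = (y, t)" and Z: "Z = (z, r)"
      by (metis prod.exhaust)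
    have c: "x \<in> carrier M" "s \<in> S" "y \<in> carrier M" "t \<in> S" "z \<in> carrier M" "r \<in> S"
      using XY YZ unfolding X Y Z fraction_rel_iff by auto
    obtain u where u: "u \<in> S" "(u \<otimes> t) \<odot>\<^bsub>M\<^esub> x = (u \<otimes> s) \<odot>\<^bsub>M\<^esub> y"
      using XY unfolding X Y fraction_rel_iff by auto
    obtain v where v: "v \<in> S" "(v \<otimes> r) \<odot>\<^bsub>M\<^esub> y = (v \<otimes> t) \<odot>\<^bsub>M\<^esub> z"
      using YZ unfolding Y Z fraction_rel_iff by auto
    note cc = c u(1) v(1)
    have "((u \<otimes> v \<otimes> t) \<otimes> r) \<odot>\<^bsub>M\<^esub> x = (v \<otimes> r) \<odot>\<^bsub>M\<^esub> ((u \<otimes> t) \<odot>\<^bsub>M\<^esub> x)"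
      using cc by (simp add: m_ac flip: smult_assoc1)
    also have "\<dots> = (u \<otimes> s) \<odot>\<^bsub>M\<^esub> ((v \<otimes> r) \<odot>\<^bsub>M\<^esub> y)"
      unfolding u(2) using cc by (simp add: m_ac flip: smult_assoc1)
    also have "\<dots> = ((u \<otimes> v \<otimes> t) \<otimes> s) \<odot>\<^bsub>M\<^esub> z"
      unfolding v(2) using cc by (simp add: m_ac flip: smult_assoc1)
    finally have "((u \<otimes> v \<otimes> t) \<otimes> r) \<odot>\<^bsub>M\<^esub> x = ((u \<otimes> v \<otimes> t) \<otimes> s) \<odot>\<^bsub>M\<^esub> z" .
    then show "(X, Z) \<in> fraction_rel R S M"
      unfolding X Z fraction_rel_iff using cc S_mult by auto
  qed
qed

lemma fraction_eq_iff:
  assumes "x \<in> carrier M" "s \<in> S" "y \<in> carrier M" "t \<in> S"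
  shows "fraction R S M x s = fraction R S M y t \<longleftrightarrow>
    (\<exists>u\<in>S. (u \<otimes> t) \<odot>\<^bsub>M\<^esub> x = (u \<otimes> s) \<odot>\<^bsub>M\<^esub> y)"
  using eq_equiv_class_iff[OF equiv_fraction_rel, of "(x, s)" "(y, t)"] assms
  by (simp add: fraction_def fraction_rel_iff)

lemma mem_fraction_iff:
  assumes "x \<in> carrier M" "s \<in> S"
  shows "(y, t) \<in> fraction R S M x s \<longleftrightarrow>
    y \<in> carrier M \<and> t \<in> S \<and> (\<exists>u\<in>S. (u \<otimes> t) \<odot>\<^bsub>M\<^esub> x = (u \<otimes> s) \<odot>\<^bsub>M\<^esub> y)"
  using assms by (simp add: fraction_def fraction_rel_iff)

lemma self_mem_fraction:
  assumes "x \<in> carrier M" "s \<in> S"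
  shows "(x, s) \<in> fraction R S M x s"
  using assms S_one by (auto simp: mem_fraction_iff)

lemma loc_carrierE:
  assumes "X \<in> carrier (loc_module R S M)"
  obtains x s where "x \<in> carrier M" "s \<in> S" "X = fraction R S M x s"
  using assms that by (auto simp: loc_module_def fraction_def elim: quotientE)

lemma fraction_in_loc [simp]:
  assumes "x \<in> carrier M" "s \<in> S"
  shows "fraction R S M x s \<in> carrier (loc_module R S M)"
  using assms by (auto simp: loc_module_def fraction_def intro: quotientI)

lemma fraction_cancel:
  assumes "x \<in> carrier M" "s \<in> S" "u \<in> S"
  shows "fraction R S M (u \<odot>\<^bsub>M\<^esub> x) (u \<otimes> s) = fraction R S M x s"
proof -
  have "(\<one> \<otimes> s) \<odot>\<^bsub>M\<^esub> (u \<odot>\<^bsub>M\<^esub> x) = (\<one> \<otimes> (u \<otimes> s)) \<odot>\<^bsub>M\<^esub> x"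
    using assms by (simp add: m_ac flip: smult_assoc1)
  then have "\<exists>v\<in>S. (v \<otimes> s) \<odot>\<^bsub>M\<^esub> (u \<odot>\<^bsub>M\<^esub> x) = (v \<otimes> (u \<otimes> s)) \<odot>\<^bsub>M\<^esub> x"
    using S_one by (rule bexI)
  then show ?thesis using assms S_mult by (subst fraction_eq_iff) auto
qed

lemma Union_constant:
  assumes "X \<noteq> {}" "\<And>z. z \<in> X \<Longrightarrow> F z = C"
  shows "(\<Union>z\<in>X. F z) = C"
  using assms by auto

lemma fraction_add:
  assumes "x \<in> carrier M" "s \<in> S" "y \<in> carrier M" "t \<in> S"
  shows "fraction R S M x s \<oplus>\<^bsub>loc_module R S M\<^esub> fraction R S M y t =
    fraction R S M (t \<odot>\<^bsub>M\<^esub> x \<oplus>\<^bsub>M\<^esub> s \<odot>\<^bsub>M\<^esub> y) (s \<otimes> t)" (is "_ = ?C")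
proof -
  have "fraction R S M ((t' \<odot>\<^bsub>M\<^esub> x') \<oplus>\<^bsub>M\<^esub> (s' \<odot>\<^bsub>M\<^esub> y')) (s' \<otimes> t') = ?C"
    if X: "(x', s') \<in> fraction R S M x s" and Y: "(y', t') \<in> fraction R S M y t" for x' s' y' t'
  proof -
    obtain u where u: "u \<in> S" "(u \<otimes> s') \<odot>\<^bsub>M\<^esub> x = (u \<otimes> s) \<odot>\<^bsub>M\<^esub> x'"
      and x': "x' \<in> carrier M" "s' \<in> S"
      using X assms by (auto simp: mem_fraction_iff)
    obtain v where v: "v \<in> S" "(v \<otimes> t') \<odot>\<^bsub>M\<^esub> y = (v \<otimes> t) \<odot>\<^bsub>M\<^esub> y'"
      and y': "y' \<in> carrier M" "t' \<in> S"
      using Y assms by (auto simp: mem_fraction_iff)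
    note cc = assms u(1) v(1) x' y'
    have "((u \<otimes> v) \<otimes> (s' \<otimes> t')) \<odot>\<^bsub>M\<^esub> (t \<odot>\<^bsub>M\<^esub> x \<oplus>\<^bsub>M\<^esub> s \<odot>\<^bsub>M\<^esub> y) =
        (v \<otimes> t' \<otimes> t) \<odot>\<^bsub>M\<^esub> ((u \<otimes> s') \<odot>\<^bsub>M\<^esub> x) \<oplus>\<^bsub>M\<^esub> (u \<otimes> s \<otimes> s') \<odot>\<^bsub>M\<^esub> ((v \<otimes> t') \<odot>\<^bsub>M\<^esub> y)"
      using cc by (simp add: smult_r_distr m_ac flip: smult_assoc1)
    also have "\<dots> = ((u \<otimes> v) \<otimes> (s \<otimes> t)) \<odot>\<^bsub>M\<^esub> (t' \<odot>\<^bsub>M\<^esub> x' \<oplus>\<^bsub>M\<^esub> s' \<odot>\<^bsub>M\<^esub> y')"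
      unfolding u(2) v(2) using cc by (simp add: smult_r_distr m_ac flip: smult_assoc1)
    finally show ?thesis
      using cc S_mult by (subst fraction_eq_iff) (auto intro!: bexI[of _ "u \<otimes> v"])
  qed
  note const = this
  have "(\<Union>(x', s')\<in>fraction R S M x s. \<Union>(y', t')\<in>fraction R S M y t.
      fraction R S M ((t' \<odot>\<^bsub>M\<^esub> x') \<oplus>\<^bsub>M\<^esub> (s' \<odot>\<^bsub>M\<^esub> y')) (s' \<otimes> t')) = ?C"
  proof (rule Union_constant)
    show "fraction R S M x s \<noteq> {}" using self_mem_fraction assms by auto
    fix X assume X: "X \<in> fraction R S M x s"
    show "(case X of (x', s') \<Rightarrow> \<Union>(y', t')\<in>fraction R S M y t.
        fraction R S M ((t' \<odot>\<^bsub>M\<^esub> x') \<oplus>\<^bsub>M\<^esub> (s' \<odot>\<^bsub>M\<^esub> y')) (s' \<otimes> t')) = ?C"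
    proof (cases X)
      case (Pair x' s')
      have "(\<Union>(y', t')\<in>fraction R S M y t.
          fraction R S M ((t' \<odot>\<^bsub>M\<^esub> x') \<oplus>\<^bsub>M\<^esub> (s' \<odot>\<^bsub>M\<^esub> y')) (s' \<otimes> t')) = ?C"
      proof (rule Union_constant)
        show "fraction R S M y t \<noteq> {}" using self_mem_fraction assms by auto
        fix Y assume "Y \<in> fraction R S M y t"
        then show "(case Y of (y', t') \<Rightarrow>
            fraction R S M ((t' \<odot>\<^bsub>M\<^esub> x') \<oplus>\<^bsub>M\<^esub> (s' \<odot>\<^bsub>M\<^esub> y')) (s' \<otimes> t')) = ?C"
          using const X Pair by (cases Y) simp
      qed
      then show ?thesis using Pair by simp
    qed
  qed
  then show ?thesis by (simp add: loc_module_def)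
qed

end

context module_localization
begin

lemma regular_localization: "module_localization R (regular_module R) S"
  by (intro module_localization.intro module_localization_axioms.intro R.regular_module_module)
    (use S_one S_mult in auto)

interpretation L: module_localization R "regular_module R" S
  by (rule regular_localization)

lemma fraction_smult:
  assumes "a \<in> carrier R" "s \<in> S" "x \<in> carrier M" "t \<in> S"
  shows "fraction R S (regular_module R) a s \<odot>\<^bsub>loc_module R S M\<^esub> fraction R S M x t =
    fraction R S M (a \<odot>\<^bsub>M\<^esub> x) (s \<otimes> t)" (is "_ = ?C")
proof -
  let ?A = "fraction R S (regular_module R) a s"
  have ra: "a \<in> carrier (regular_module R)" using assms by (simp add: regular_module_def)
  have const: "fraction R S M (a' \<odot>\<^bsub>M\<^esub> x') (s' \<otimes> t') = ?C"
    if A: "(a', s') \<in> ?A" and X: "(x', t') \<in> fraction R S M x t" for a' s' x' t'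
  proof -
    obtain u where u: "u \<in> S" "(u \<otimes> s') \<otimes> a = (u \<otimes> s) \<otimes> a'"
      and a': "a' \<in> carrier R" "s' \<in> S"
      using A L.mem_fraction_iff[OF ra assms(2)] by (auto simp: regular_module_def)
    obtain v where v: "v \<in> S" "(v \<otimes> t') \<odot>\<^bsub>M\<^esub> x = (v \<otimes> t) \<odot>\<^bsub>M\<^esub> x'"
      and x': "x' \<in> carrier M" "t' \<in> S"
      using X assms by (auto simp: mem_fraction_iff)
    note cc = assms u(1) v(1) x' a'
    have "((u \<otimes> v) \<otimes> (s' \<otimes> t')) \<odot>\<^bsub>M\<^esub> (a \<odot>\<^bsub>M\<^esub> x) =
        ((u \<otimes> s') \<otimes> a) \<odot>\<^bsub>M\<^esub> ((v \<otimes> t') \<odot>\<^bsub>M\<^esub> x)"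
      using cc by (simp add: m_ac flip: smult_assoc1)
    also have "\<dots> = ((u \<otimes> v) \<otimes> (s \<otimes> t)) \<odot>\<^bsub>M\<^esub> (a' \<odot>\<^bsub>M\<^esub> x')"
      unfolding u(2) v(2) using cc by (simp add: m_ac flip: smult_assoc1)
    finally show ?thesis
      using cc S_mult by (subst fraction_eq_iff) (auto intro!: bexI[of _ "u \<otimes> v"])
  qed
  have "(\<Union>(a', s')\<in>?A. \<Union>(x', t')\<in>fraction R S M x t.
      fraction R S M (a' \<odot>\<^bsub>M\<^esub> x') (s' \<otimes> t')) = ?C"
  proof (rule Union_constant)
    show "?A \<noteq> {}" using L.self_mem_fraction[OF ra assms(2)] by auto
    fix A assume A: "A \<in> ?A"
    show "(case A of (a', s') \<Rightarrow> \<Union>(x', t')\<in>fraction R S M x t.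
        fraction R S M (a' \<odot>\<^bsub>M\<^esub> x') (s' \<otimes> t')) = ?C"
    proof (cases A)
      case (Pair a' s')
      have "(\<Union>(x', t')\<in>fraction R S M x t. fraction R S M (a' \<odot>\<^bsub>M\<^esub> x') (s' \<otimes> t')) = ?C"
      proof (rule Union_constant)
        show "fraction R S M x t \<noteq> {}" using self_mem_fraction assms by auto
        fix X assume "X \<in> fraction R S M x t"
        then show "(case X of (x', t') \<Rightarrow> fraction R S M (a' \<odot>\<^bsub>M\<^esub> x') (s' \<otimes> t')) = ?C"
          using const A Pair by (cases X) simp
      qed
      then show ?thesis using Pair by simp
    qed
  qed
  then show ?thesis by (simp add: loc_module_def)
qed

end

context module_localization
begin

\<comment> \<open>Reopening the context makes \<open>fraction_smult\<close> available for the regular module as well.\<close>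
interpretation L: module_localization R "regular_module R" S
  by (rule regular_localization)

abbreviation frac :: "'a \<Rightarrow> 'a \<Rightarrow> ('a \<times> 'a) set" where
  "frac a s \<equiv> fraction R S (regular_module R) a s"

abbreviation "RS \<equiv> loc_ring R S"

lemma RS_simps:
  "carrier RS = carrier (loc_module R S (regular_module R))"
  "\<one>\<^bsub>RS\<^esub> = frac \<one> \<one>" "\<zero>\<^bsub>RS\<^esub> = frac \<zero> \<one>"
  "add RS = add (loc_module R S (regular_module R))"
  "monoid.mult RS = smult (loc_module R S (regular_module R))"
  by (simp_all add: loc_ring_def Let_def) (simp add: loc_module_def regular_module_def)

lemma frac_closed: "a \<in> carrier R \<Longrightarrow> s \<in> S \<Longrightarrow> frac a s \<in> carrier RS"
  unfolding RS_simps by (rule L.fraction_in_loc) (simp_all add: regular_module_def)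

lemma RS_carrierE:
  assumes "c \<in> carrier RS"
  obtains a s where "a \<in> carrier R" "s \<in> S" "c = frac a s"
  using assms unfolding RS_simps
  by (rule L.loc_carrierE) (use that in \<open>simp add: regular_module_def\<close>)

lemma frac_add:
  assumes "a \<in> carrier R" "s \<in> S" "b \<in> carrier R" "t \<in> S"
  shows "frac a s \<oplus>\<^bsub>RS\<^esub> frac b t = frac (t \<otimes> a \<oplus> s \<otimes> b) (s \<otimes> t)"
  unfolding RS_simps using L.fraction_add[of a s b t] assms by (simp add: regular_module_def)

lemma frac_mult:
  assumes "a \<in> carrier R" "s \<in> S" "b \<in> carrier R" "t \<in> S"
  shows "frac a s \<otimes>\<^bsub>RS\<^esub> frac b t = frac (a \<otimes> b) (s \<otimes> t)"
  unfolding RS_simps using L.fraction_smult[of a s b t] assms by (simp add: regular_module_def)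

lemma frac_cancel:
  assumes "a \<in> carrier R" "s \<in> S" "u \<in> S"
  shows "frac (u \<otimes> a) (u \<otimes> s) = frac a s"
  using L.fraction_cancel[of a s u] assms by (simp add: regular_module_def)

lemma frac_eq_iff:
  assumes "a \<in> carrier R" "s \<in> S" "b \<in> carrier R" "t \<in> S"
  shows "frac a s = frac b t \<longleftrightarrow> (\<exists>u\<in>S. (u \<otimes> t) \<otimes> a = (u \<otimes> s) \<otimes> b)"
  using L.fraction_eq_iff[of a s b t] assms by (simp add: regular_module_def)

text \<open>
  Finitely many conditions on a denominator that persist when the denominator is enlarged can be
  met by one denominator.
\<close>

lemma common_denominator:
  fixes n :: nat
  assumes "\<And>i. i < n \<Longrightarrow> \<exists>t\<in>S. P i t"
    and scale: "\<And>i t u. i < n \<Longrightarrow> t \<in> S \<Longrightarrow> u \<in> S \<Longrightarrow> P i t \<Longrightarrow> P i (u \<otimes> t)"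
  shows "\<exists>t\<in>S. \<forall>i<n. P i t"
  using assms
proof (induction n)
  case 0
  then show ?case using S_one by auto
next
  case (Suc n)
  have "\<exists>t\<in>S. \<forall>i<n. P i t" by (rule Suc.IH) (use Suc.prems in auto)
  then obtain t where t: "t \<in> S" "\<And>i. i < n \<Longrightarrow> P i t" by auto
  obtain u where u: "u \<in> S" "P n u" using Suc.prems(1)[of n] by auto
  have "P i (u \<otimes> t)" if "i < Suc n" for i
  proof (cases "i = n")
    case True
    then show ?thesis using Suc.prems(2)[of n u t] t u by (simp add: m_comm)
  next
    case False
    then show ?thesis using Suc.prems(2)[of i t u] t u that by auto
  qed
  then show ?case using S_mult[OF u(1) t(1)] by auto
qed

text \<open>
  For finitely generated projective \<open>M\<close> every linear form on the localization is a quotient of a linear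
  form on \<open>M\<close> by an element of \<open>S\<close>, because it is determined by its values on the finitely many
  \<open>h\<^sub>k\<close>.
\<close>

lemma linear_form_clear_denominators:
  assumes basis: "dual_basis R M Y h \<psi>"
    and l_closed: "\<And>y. y \<in> carrier M \<Longrightarrow> l y \<in> carrier RS"
    and l_add: "\<And>y z. y \<in> carrier M \<Longrightarrow> z \<in> carrier M \<Longrightarrow> l (y \<oplus>\<^bsub>M\<^esub> z) = l y \<oplus>\<^bsub>RS\<^esub> l z"
    and l_smult: "\<And>a y. a \<in> carrier R \<Longrightarrow> y \<in> carrier M \<Longrightarrow> l (a \<odot>\<^bsub>M\<^esub> y) = frac a \<one> \<otimes>\<^bsub>RS\<^esub> l y"
  shows "\<exists>t\<in>S. \<exists>\<phi>\<in>dual R M. \<forall>y\<in>carrier M. l y = frac (\<phi> y) t"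
proof -
  have Y: "finite Y" and h: "\<And>k. k \<in> Y \<Longrightarrow> h k \<in> carrier M" and \<psi>: "\<And>k. k \<in> Y \<Longrightarrow> \<psi> k \<in> dual R M"
    and expand: "\<And>y. y \<in> carrier M \<Longrightarrow> y = (\<Oplus>\<^bsub>M\<^esub>k\<in>Y. \<psi> k y \<odot>\<^bsub>M\<^esub> h k)"
    using basis by (auto simp: dual_basis_def)
  \<comment> \<open>Partial sums of the expansion of \<open>y\<close> are treated uniformly in \<open>y\<close>, by induction on the index set.\<close>
  have "\<exists>t\<in>S. \<exists>\<phi>\<in>dual R M. \<forall>y\<in>carrier M. l (\<Oplus>\<^bsub>M\<^esub>k\<in>Y'. \<psi> k y \<odot>\<^bsub>M\<^esub> h k) = frac (\<phi> y) t"
    if "finite Y'" "Y' \<subseteq> Y" for Y'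
    using that
  proof (induction Y')
    case empty
    obtain a s where as: "a \<in> carrier R" "s \<in> S" "l \<zero>\<^bsub>M\<^esub> = frac a s"
      using RS_carrierE[OF l_closed[OF M.zero_closed]] by metis
    have "l \<zero>\<^bsub>M\<^esub> = frac \<zero> \<one> \<otimes>\<^bsub>RS\<^esub> l \<zero>\<^bsub>M\<^esub>"
      using l_smult[OF R.zero_closed M.zero_closed] by simp
    then have "l \<zero>\<^bsub>M\<^esub> = frac \<zero> s" using as S_one by (simp add: frac_mult)
    then show ?case using dual_zero_form as(2) by auto
  next
    case (insert k Y')
    then obtain t \<phi> where t: "t \<in> S" and \<phi>: "\<phi> \<in> dual R M"
      and IH: "\<And>y. y \<in> carrier M \<Longrightarrow> l (\<Oplus>\<^bsub>M\<^esub>k\<in>Y'. \<psi> k y \<odot>\<^bsub>M\<^esub> h k) = frac (\<phi> y) t"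
      by auto
    have k: "k \<in> Y" using insert.prems by simp
    obtain c s where cs: "c \<in> carrier R" "s \<in> S" "l (h k) = frac c s"
      using RS_carrierE[OF l_closed[OF h[OF k]]] by metis
    define \<phi>' where "\<phi>' y = (t \<otimes> c) \<otimes> \<psi> k y \<oplus> s \<otimes> \<phi> y" for y
    have "\<phi>' \<in> dual R M"
      unfolding \<phi>'_def using t cs \<phi> \<psi>[OF k] by (intro dual_plus dual_scale) auto
    moreover have "l (\<Oplus>\<^bsub>M\<^esub>k\<in>insert k Y'. \<psi> k y \<odot>\<^bsub>M\<^esub> h k) = frac (\<phi>' y) (s \<otimes> t)"
      if y: "y \<in> carrier M" for y
    proof -
      have \<psi>y: "\<psi> k y \<in> carrier R" and \<phi>y: "\<phi> y \<in> carrier R" using \<psi>[OF k] \<phi> y by auto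
      have terms: "(\<lambda>k. \<psi> k y \<odot>\<^bsub>M\<^esub> h k) \<in> Y' \<rightarrow> carrier M"
        using insert.prems h \<psi> y by (auto simp: subset_iff)
      have "(\<Oplus>\<^bsub>M\<^esub>k\<in>insert k Y'. \<psi> k y \<odot>\<^bsub>M\<^esub> h k) =
          \<psi> k y \<odot>\<^bsub>M\<^esub> h k \<oplus>\<^bsub>M\<^esub> (\<Oplus>\<^bsub>M\<^esub>k\<in>Y'. \<psi> k y \<odot>\<^bsub>M\<^esub> h k)"
        by (rule M.finsum_insert) (use insert.hyps terms \<psi>y h[OF k] in auto)
      then have "l (\<Oplus>\<^bsub>M\<^esub>k\<in>insert k Y'. \<psi> k y \<odot>\<^bsub>M\<^esub> h k) =
          frac (\<psi> k y) \<one> \<otimes>\<^bsub>RS\<^esub> frac c s \<oplus>\<^bsub>RS\<^esub> frac (\<phi> y) t"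
        using l_add[OF smult_closed[OF \<psi>y h[OF k]] M.finsum_closed[OF terms]]
          l_smult[OF \<psi>y h[OF k]] IH[OF y] cs(3) by simp
      also have "\<dots> = frac (t \<otimes> (\<psi> k y \<otimes> c) \<oplus> s \<otimes> \<phi> y) (s \<otimes> t)"
        using \<psi>y \<phi>y cs t S_one by (simp add: frac_mult frac_add)
      also have "t \<otimes> (\<psi> k y \<otimes> c) \<oplus> s \<otimes> \<phi> y = \<phi>' y"
        unfolding \<phi>'_def using \<psi>y \<phi>y cs t by (simp add: m_ac)
      finally show ?thesis .
    qed
    ultimately show ?case using S_mult[OF cs(2) t] by auto
  qed
  from this[OF Y subset_refl] show ?thesis using expand by simp
qed

text \<open>
  Let \<open>l\<^sub>i\<close> be the coordinate forms of the free localization.  They equal \<open>\<phi>\<^sub>i / t\<close>, and the basis vectors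
  equal \<open>x\<^sub>j / t'\<close>.  In the localized ring this gives \<open>\<phi>\<^sub>i(x\<^sub>j) = t t'\<close> for \<open>i = j\<close> and \<open>0\<close> otherwise,
  which becomes an equation in \<open>R\<close> after multiplication by some \<open>u \<in> S\<close>.
\<close>

lemma frame_from_free_localization:
  assumes basis: "dual_basis R M Y h \<psi>"
    and iso: "module_iso RS (loc_module R S M) (free_module RS {..<r})"
  shows "\<exists>\<delta>\<in>S. frame R M (carrier M) r \<delta>"
proof -
  obtain \<Phi> where \<Phi>: "\<Phi> \<in> module_hom RS (loc_module R S M) (free_module RS {..<r})"
    and bij: "bij_betw \<Phi> (carrier (loc_module R S M)) (carrier (free_module RS {..<r}))"
    using iso by (auto simp: module_iso_def)
  define l where "l i y = \<Phi> (fraction R S M y \<one>) i" for i y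
  have "\<exists>t\<in>S. \<exists>\<phi>\<in>dual R M. \<forall>y\<in>carrier M. l i y = frac (\<phi> y) t" if i: "i < r" for i
  proof (rule linear_form_clear_denominators[OF basis])
    show "l i y \<in> carrier RS" if "y \<in> carrier M" for y
      using module_hom_closed[OF \<Phi> fraction_in_loc[OF that S_one]] i
      by (auto simp: l_def)
    show "l i (y \<oplus>\<^bsub>M\<^esub> z) = l i y \<oplus>\<^bsub>RS\<^esub> l i z" if "y \<in> carrier M" "z \<in> carrier M" for y z
    proof -
      have "fraction R S M (y \<oplus>\<^bsub>M\<^esub> z) \<one> =
          fraction R S M y \<one> \<oplus>\<^bsub>loc_module R S M\<^esub> fraction R S M z \<one>"
        using that S_one by (simp add: fraction_add)
      then show ?thesis
        using module_hom_add[OF \<Phi> fraction_in_loc fraction_in_loc] that S_one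
        by (simp add: l_def)
    qed
    show "l i (a \<odot>\<^bsub>M\<^esub> y) = frac a \<one> \<otimes>\<^bsub>RS\<^esub> l i y" if "a \<in> carrier R" "y \<in> carrier M" for a y
    proof -
      have "fraction R S M (a \<odot>\<^bsub>M\<^esub> y) \<one> =
          frac a \<one> \<odot>\<^bsub>loc_module R S M\<^esub> fraction R S M y \<one>"
        using that S_one by (simp add: fraction_smult)
      then show ?thesis
        using module_hom_smult[OF \<Phi> frac_closed fraction_in_loc] that S_one
        by (simp add: l_def)
    qed
  qed
  then have "\<exists>t\<in>S. \<forall>i<r. \<exists>\<phi>\<in>dual R M. \<forall>y\<in>carrier M. l i y = frac (\<phi> y) t"
  proof (rule common_denominator)
    fix i t u assume t: "t \<in> S" and u: "u \<in> S"
      and "\<exists>\<phi>\<in>dual R M. \<forall>y\<in>carrier M. l i y = frac (\<phi> y) t"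
    then obtain \<phi> where \<phi>: "\<phi> \<in> dual R M" "\<And>y. y \<in> carrier M \<Longrightarrow> l i y = frac (\<phi> y) t" by auto
    show "\<exists>\<phi>\<in>dual R M. \<forall>y\<in>carrier M. l i y = frac (\<phi> y) (u \<otimes> t)"
      by (rule bexI[of _ "\<lambda>y. u \<otimes> \<phi> y"])
        (use \<phi> t u in \<open>auto simp: frac_cancel intro: dual_scale\<close>)
  qed
  then obtain t \<phi> where t: "t \<in> S" and \<phi>: "\<And>i. i < r \<Longrightarrow> \<phi> i \<in> dual R M"
    and l\<phi>: "\<And>i y. i < r \<Longrightarrow> y \<in> carrier M \<Longrightarrow> l i y = frac (\<phi> i y) t" by metis
  define e where "e j = (\<lambda>i. if i = j then \<one>\<^bsub>RS\<^esub> else \<zero>\<^bsub>RS\<^esub>)" for j :: nat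
  have "\<exists>t\<in>S. \<exists>x\<in>carrier M. \<Phi> (fraction R S M x t) = e j" if j: "j < r" for j
  proof -
    have "\<one>\<^bsub>RS\<^esub> \<in> carrier RS" "\<zero>\<^bsub>RS\<^esub> \<in> carrier RS"
      using frac_closed S_one by (auto simp: RS_simps(2,3))
    then have "e j \<in> carrier (free_module RS {..<r})" using j by (auto simp: e_def)
    then obtain X where "X \<in> carrier (loc_module R S M)" "\<Phi> X = e j"
      using bij by (metis bij_betw_imp_surj_on imageE)
    then show ?thesis by (metis loc_carrierE)
  qed
  then have "\<exists>t\<in>S. \<forall>j<r. \<exists>x\<in>carrier M. \<Phi> (fraction R S M x t) = e j"
  proof (rule common_denominator)
    fix j t u assume t: "t \<in> S" and u: "u \<in> S"
      and "\<exists>x\<in>carrier M. \<Phi> (fraction R S M x t) = e j"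
    then obtain x where x: "x \<in> carrier M" "\<Phi> (fraction R S M x t) = e j" by auto
    show "\<exists>x\<in>carrier M. \<Phi> (fraction R S M x (u \<otimes> t)) = e j"
      by (rule bexI[of _ "u \<odot>\<^bsub>M\<^esub> x"]) (use x t u in \<open>auto simp: fraction_cancel\<close>)
  qed
  then obtain t' x where t': "t' \<in> S" and x: "\<And>j. j < r \<Longrightarrow> x j \<in> carrier M"
    and \<Phi>x: "\<And>j. j < r \<Longrightarrow> \<Phi> (fraction R S M (x j) t') = e j" by metis
  define d where "d i j = (if i = j then t \<otimes> t' else \<zero>)" for i j :: nat
  have d: "d i j \<in> carrier R" for i j using t t' by (simp add: d_def)
  have "\<exists>u\<in>S. u \<otimes> \<phi> i (x j) = u \<otimes> d i j" if i: "i < r" and j: "j < r" for i j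
  proof -
    define k where "k = (if i = j then \<one> else \<zero>)"
    have k: "k \<in> carrier R" by (simp add: k_def)
    have \<phi>x: "\<phi> i (x j) \<in> carrier R" using \<phi>[OF i] x[OF j] by simp
    have "fraction R S M (x j) \<one> = fraction R S M (t' \<odot>\<^bsub>M\<^esub> x j) (t' \<otimes> \<one>)"
      using x[OF j] S_one t' by (rule fraction_cancel[symmetric])
    also have "\<dots> = frac t' \<one> \<odot>\<^bsub>loc_module R S M\<^esub> fraction R S M (x j) t'"
      using x[OF j] t' S_one by (simp add: fraction_smult)
    finally have "l i (x j) = frac t' \<one> \<otimes>\<^bsub>RS\<^esub> e j i"
      using module_hom_smult[OF \<Phi> frac_closed fraction_in_loc, of t' \<one> "x j" t'] \<Phi>x[OF j]
        x[OF j] t' S_one by (simp add: l_def)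
    also have "e j i = frac k \<one>" by (simp add: e_def k_def RS_simps(2,3))
    finally have "frac (\<phi> i (x j)) t = frac (t' \<otimes> k) \<one>"
      using l\<phi>[OF i x[OF j]] k t' S_one by (simp add: frac_mult)
    then obtain u where u: "u \<in> S" "(u \<otimes> \<one>) \<otimes> \<phi> i (x j) = (u \<otimes> t) \<otimes> (t' \<otimes> k)"
      using \<phi>x k t t' S_one by (auto simp: frac_eq_iff)
    have "(u \<otimes> t) \<otimes> (t' \<otimes> k) = u \<otimes> d i j" using u t t' by (simp add: d_def k_def m_assoc)
    then show ?thesis using u by auto
  qed
  then have "\<exists>u\<in>S. \<forall>j<r. u \<otimes> \<phi> i (x j) = u \<otimes> d i j" if i: "i < r" for i
  proof (rule common_denominator)
    fix j u v assume "j < r" "u \<in> S" "v \<in> S" "u \<otimes> \<phi> i (x j) = u \<otimes> d i j"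
    then show "(v \<otimes> u) \<otimes> \<phi> i (x j) = (v \<otimes> u) \<otimes> d i j"
      using \<phi>[OF i] x[of j] d by (simp add: m_assoc)
  qed (use i in auto)
  then have "\<exists>u\<in>S. \<forall>i<r. \<forall>j<r. u \<otimes> \<phi> i (x j) = u \<otimes> d i j"
  proof (rule common_denominator)
    fix i u v assume "i < r" "u \<in> S" "v \<in> S" "\<forall>j<r. u \<otimes> \<phi> i (x j) = u \<otimes> d i j"
    then show "\<forall>j<r. (v \<otimes> u) \<otimes> \<phi> i (x j) = (v \<otimes> u) \<otimes> d i j"
      using \<phi>[of i] x d by (simp add: m_assoc)
  qed auto
  then obtain u where u: "u \<in> S" and eq: "\<And>i j. i < r \<Longrightarrow> j < r \<Longrightarrow> u \<otimes> \<phi> i (x j) = u \<otimes> d i j"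
    by auto
  have "frame R M (carrier M) r (u \<otimes> (t \<otimes> t'))"
    unfolding frame_def
    by (rule exI[of _ "\<lambda>i y. u \<otimes> \<phi> i y"], rule exI[of _ x])
      (use \<phi> x eq u in \<open>auto simp: d_def intro: dual_scale\<close>)
  then show ?thesis using S_mult[OF u S_mult[OF t t']] by auto
qed

end

lemma local_frames_if_constant_rank:
  fixes M :: "('a, 'b, 'm) module_scheme"
  assumes "fg_projective R M" and rank: "has_constant_rank R M r"
  shows "local_frames R M r"
  unfolding local_frames_def
proof
  interpret Module.module R M using assms by (simp add: fg_projective_def projective_def)
  obtain Y :: "'b set" and h \<psi> where basis: "dual_basis R M Y h \<psi>"
    using fg_projective_dual_basis[OF assms(1)] by metis
  fix Q assume Q: "Q \<in> Spec R"
  interpret Q: primeideal Q R using Q by (simp add: Spec_def)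
  interpret module_localization R M "carrier R - Q"
    by unfold_locales (use Q.one_notin Q.I_prime in auto)
  show "\<exists>\<delta>\<in>carrier R - Q. frame R M (carrier M) r \<delta>"
    by (rule frame_from_free_localization[OF basis])
      (use rank Q in \<open>simp add: has_constant_rank_def Let_def\<close>)
qed

section \<open>Splitting and cancellation for projective modules\<close>

theorem corollary2p7:
  fixes R :: "'a ring" and s :: 'a and d r :: nat
    and P :: "('a, 'b) module" and p :: 'b and P1 :: "'b set"
  assumes "cring R" and "\<one>\<^bsub>R\<^esub> \<noteq> \<zero>\<^bsub>R\<^esub>" and "s \<in> carrier R"
    and "krull_dim (subtopology (zariski R) (vanishing_set R s)) \<le> ereal (real d)"
    and "krull_dim (subtopology (zariski R) (nonvanishing_set R s)) \<le> ereal (real d)"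
    and "fg_projective R P" and "has_constant_rank R P r" and "r \<ge> d + 1"
    and "p \<in> carrier P" and "submodule P1 R P"
    and "carrier P = {(a \<odot>\<^bsub>P\<^esub> p) \<oplus>\<^bsub>P\<^esub> q | a q. a \<in> carrier R \<and> q \<in> P1}"
  shows "(\<exists>q\<in>P1. unimodular R P (p \<oplus>\<^bsub>P\<^esub> q)) \<and>
    (\<forall>(P' :: ('a, 'c) module) (Q :: ('a, 'e) module).
       fg_projective R P' \<longrightarrow> fg_projective R Q \<longrightarrow>
       module_iso R (direct_sum P Q) (direct_sum P' Q) \<longrightarrow> module_iso R P P')"
proof (intro conjI allI impI)
  have P: "Module.module R P" using assms(6) by (simp add: fg_projective_def projective_def)
  interpret P: Module.module R P by (rule P)
  have K: "kronecker_range R r"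
  proof (rule P.kronecker_range_two_strata[OF assms(3)])
    show "\<not> has_chain (vanishing_set R s) r"
      by (rule no_chain_if_krull_dim_le[OF _ assms(4)]) (use assms(8) in \<open>auto simp: vanishing_set_def\<close>)
    show "\<not> has_chain (nonvanishing_set R s) r"
      by (rule no_chain_if_krull_dim_le[OF _ assms(5)]) (use assms(8) in \<open>auto simp: nonvanishing_set_def\<close>)
  qed
  have fr: "local_frames R P r" using local_frames_if_constant_rank[OF assms(6,7)] .
  show "\<exists>q\<in>P1. unimodular R P (p \<oplus>\<^bsub>P\<^esub> q)"
  proof (rule P.unimodular_in_coset[OF K assms(10,9)])
    fix Q assume Q: "Q \<in> Spec R" and van: "vanishes_at R P Q p"
    then obtain \<delta> where "\<delta> \<in> carrier R - Q" "frame R P (carrier P) r \<delta>"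
      using fr unfolding local_frames_def by metis
    then show "\<exists>\<delta>\<in>carrier R - Q. frame R P P1 r \<delta>"
      by (rule P.frame_in_complement[OF Q assms(9,10,11) van])
  qed
  fix P' :: "('a, 'c) module" and Q :: "('a, 'e) module"
  assume P': "fg_projective R P'" and Q: "fg_projective R Q"
    and iso: "module_iso R (direct_sum P Q) (direct_sum P' Q)"
  have P'm: "Module.module R P'" and Qm: "Module.module R Q"
    using P' Q by (simp_all add: fg_projective_def projective_def)
  obtain Y :: "'e set" and h \<psi> where basis: "dual_basis R Q Y h \<psi>"
    using fg_projective_dual_basis[OF Q] by metis
  then have "finite Y" by (simp add: dual_basis_def)
  then show "module_iso R P P'"
    using cancel_free_module[OF P P'm K fr _ free_complement_iso[OF P P'm Qm basis iso]] by simp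
qed

end
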